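(* Let $\mathcal{P}$ be a polyomino such that $\mathcal{M}$ is a reduced Gröbner basis of $I_{\mathcal{P}}$ with respect to $<^i_{\mathrm{grevlex}}$ for some $i\in\mathcal{O}=\{1,3,5,7\}$ (respectively, for some $i\in\mathcal{E}=\{2,4,6,8\}$). If $v\in V(\mathcal{P})$ does not satisfy $\pi_k$ for some $k\in\mathcal{O}$ (respectively, $k\in\mathcal{E}$), then, for that $k$, $\mathcal{M}$ forms a reduced Gröbner basis of $I_{\mathcal{P}}$ with respect to $<_v^k$.
   Context: **Polyominoes.** For $a=(i,j),b=(k,\ell)\in\mathbb{N}^2$ with $i\le k$, $j\le \ell$, the interval $[a,b]$ is $\{(r,s)\in\mathbb{N}^2: i\le r\le k,\ j\le s\le \ell\}$. It is proper if $i<k$ and $j<\ell$; then $a$ (lower left) and $b$ (upper right) are its diagonal corners, and $c=(i,\ell)$ (upper left) and $d=(k,j)$ (lower right) are its anti-diagonal corners. A cell is an interval $C=[a,a+(1,1)]$; its vertex set $V(C)$ consists of its four corners, and its edges are $\{a,a+(1,0)\}$, $\{a,a+(0,1)\}$, $\{a+(1,0),a+(1,1)\}$, $\{a+(0,1),a+(1,1)\}$. A polyomino is a finite collection $\mathcal{P}$ of cells such that any two cells $C,D$ of $\mathcal{P}$ are connected by a sequence of cells $C=C_1,\dots,C_m=D$ of $\mathcal{P}$ with $C_t\cap C_{t+1}$ an edge of $C_t$ for every $t<m$. Put $V(\mathcal{P})=\bigcup_{C\in\mathcal{P}}V(C)$. A proper interval $[a,b]$ is an inner interval of $\mathcal{P}$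 if all cells contained in $[a,b]$ belong to $\mathcal{P}$. **Polyomino ideal.** Let $\mathbb{K}$ be a field and $S=\mathbb{K}[x_v\mid v\in V(\mathcal{P})]$. $\mathcal{M}$ is the set of all inner 2-minors $x_ax_b-x_cx_d$, where $[a,b]$ ranges over the inner intervals of $\mathcal{P}$ and $c,d$ are the anti-diagonal corners of $[a,b]$; $I_{\mathcal{P}}\subset S$ is the ideal generated by $\mathcal{M}$. When speaking of reduced Gröbner bases, elements of $\mathcal{M}$ are taken up to sign so that leading coefficients are $1$. **Orders.** For $a=(a_1,a_2)$, $b=(b_1,b_2)$ in $V(\mathcal{P})$ define total orders $<^1,\dots,<^8$: - $a<^1b$ iff $a_1<b_1$, or $a_1=b_1$ and $a_2>b_2$; - $a<^2b$ iff $a_1>b_1$, or $a_1=b_1$ and $a_2>b_2$; - $a<^3b$ iff $a_1>b_1$, or $a_1=b_1$ and $a_2<b_2$; - $a<^4b$ iff $a_1<b_1$, or $a_1=b_1$ and $a_2<b_2$; - $a<^5b$ iff $a_2<b_2$, or $a_2=b_2$ and $a_1>b_1$; - $a<^6b$ iff $a_2<b_2$, or $a_2=b_2$ and $a_1<b_1$; - $a<^7b$ iff $a_2>b_2$, or $a_2=b_2$ and $a_1<b_1$; - $a<^8b$ iff $a_2>b_2$, or $a_2=b_2$ and $a_1>b_1$. $<^i_{\mathrm{grevlex}}$ is the graded reverse lexicographic monomial order on $S$ whose variables are ordered by $x_a<x_b$ iff $a<^ib$. If $V(\mathcal{P})=\{v_1,\dots,v_n\}$ with $v_1<^i\cdots<^iv_n$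 and $v=v_k$, then $<^i_v$ is the graded reverse lexicographic monomial order on $S$ with variables ordered by $x_{v_k}<x_{v_{k+1}}<\cdots<x_{v_n}<x_{v_1}<\cdots<x_{v_{k-1}}$. **Conditions $\pi_i$.** For integers $x_0<x_1<x_2$ and $y_0<y_1<y_2$ consider the four intervals $LL=[(x_0,y_0),(x_1,y_1)]$, $LR=[(x_1,y_0),(x_2,y_1)]$, $UL=[(x_0,y_1),(x_1,y_2)]$, $UR=[(x_1,y_1),(x_2,y_2)]$. Say that $X\in\{LL,LR,UL,UR\}$ is the missing one if $X$ is not an inner interval of $\mathcal{P}$ while the three others are inner intervals of $\mathcal{P}$. A vertex $v\in V(\mathcal{P})$ satisfies $\pi_i$ if there are $x_0<x_1<x_2$, $y_0<y_1<y_2$ for which at least one of the corresponding (I), (II) holds: - $\pi_1$: (I) $LR$ missing, $v=(x_0,y_1)$; (II) $LL$ missing, $v=(x_1,y_1)$. - $\pi_2$: (I) $LL$ missing, $v=(x_2,y_1)$; (II) $LR$ missing, $v=(x_1,y_1)$. - $\pi_3$: (I) $UL$ missing, $v=(x_2,y_1)$; (II) $UR$ missing, $v=(x_1,y_1)$. - $\pi_4$: (I) $UR$ missing, $v=(x_0,y_1)$; (II) $UL$ missing, $v=(x_1,y_1)$. - $\pi_5$: (I) $UL$ missing, $v=(x_1,y_0)$; (II) $LL$ missing, $v=(x_1,y_1)$. - $\pi_6$: (I) $UR$ missing, $v=(x_1,y_0)$; (II) $LR$ missing, $v=(x_1,y_1)$. - $\pi_7$: (I) $LR$ missing, $v=(x_1,y_2)$;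 (II) $UR$ missing, $v=(x_1,y_1)$. - $\pi_8$: (I) $LL$ missing, $v=(x_1,y_2)$; (II) $UL$ missing, $v=(x_1,y_1)$. *)

theory Defs
  imports Main "HOL-Library.Poly_Mapping"
begin

section \<open>Polyominoes\<close>

type_synonym vertex = "nat \<times> nat"

definition interval :: "vertex \<Rightarrow> vertex \<Rightarrow> vertex set" where
  "interval a b = {fst a..fst b} \<times> {snd a..snd b}"

definition proper :: "vertex \<Rightarrow> vertex \<Rightarrow> bool" where
  "proper a b \<longleftrightarrow> fst a < fst b \<and> snd a < snd b"

definition upper_left :: "vertex \<Rightarrow> vertex \<Rightarrow> vertex" where
  "upper_left a b = (fst a, snd b)"

definition lower_right :: "vertex \<Rightarrow> vertex \<Rightarrow> vertex" where
  "lower_right a b = (fst b, snd a)"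

text \<open>A cell is an interval, hence it is the set of its own four corners.\<close>

definition cell :: "vertex \<Rightarrow> vertex set" where
  "cell a = interval a (fst a + 1, snd a + 1)"

definition is_cell :: "vertex set \<Rightarrow> bool" where
  "is_cell C \<longleftrightarrow> (\<exists>a. C = cell a)"

definition is_edge_of :: "vertex set \<Rightarrow> vertex set \<Rightarrow> bool" where
  "is_edge_of e C \<longleftrightarrow> (\<exists>i j. C = cell (i, j) \<and>
     e \<in> {{(i, j), (i + 1, j)}, {(i, j), (i, j + 1)},
          {(i + 1, j), (i + 1, j + 1)}, {(i, j + 1), (i + 1, j + 1)}})"

definition polyomino :: "vertex set set \<Rightarrow> bool" where
  "polyomino P \<longleftrightarrow> finite P \<and> (\<forall>C\<in>P. is_cell C) \<and>
     (\<forall>C\<in>P. \<forall>D\<in>P. \<exists>Cs. Cs \<noteq> [] \<and> hd Cs = C \<and> last Cs = D \<and> set Cs \<subseteq> P \<and>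
        (\<forall>t. Suc t < length Cs \<longrightarrow> is_edge_of (Cs ! t \<inter> Cs ! Suc t) (Cs ! t)))"

definition vertices :: "vertex set set \<Rightarrow> vertex set" where
  "vertices P = \<Union>P"

definition inner_interval :: "vertex set set \<Rightarrow> vertex \<Rightarrow> vertex \<Rightarrow> bool" where
  "inner_interval P a b \<longleftrightarrow> proper a b \<and> (\<forall>C. is_cell C \<and> C \<subseteq> interval a b \<longrightarrow> C \<in> P)"


section \<open>Polynomials, monomial orders and Groebner bases\<close>

text \<open>Monomials are exponent vectors and polynomials are coefficient vectors, both of
  finite support. The type contains polynomials in all variables indexed by \<open>\<nat>\<^sup>2\<close>; the
  ring \<open>K[x\<^sub>v | v \<in> V]\<close> is the subset \<open>poly_ring V\<close>, and ideals are generated over it.\<close>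

type_synonym monom = "vertex \<Rightarrow>\<^sub>0 nat"
type_synonym 'k mpoly = "monom \<Rightarrow>\<^sub>0 'k"

definition monom_poly :: "monom \<Rightarrow> 'k::field mpoly" where
  "monom_poly m = Poly_Mapping.single m 1"

definition var :: "vertex \<Rightarrow> 'k::field mpoly" where
  "var v = monom_poly (Poly_Mapping.single v 1)"

definition poly_ring :: "vertex set \<Rightarrow> 'k::field mpoly set" where
  "poly_ring V = {p. \<forall>m\<in>Poly_Mapping.keys p. Poly_Mapping.keys m \<subseteq> V}"

definition ideal_gen :: "vertex set \<Rightarrow> 'k::field mpoly set \<Rightarrow> 'k mpoly set" where
  "ideal_gen V A = {\<Sum>g\<in>F. q g * g | F q. finite F \<and> F \<subseteq> A \<and> (\<forall>g\<in>F. q g \<in> poly_ring V)}"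

definition mdegree :: "monom \<Rightarrow> nat" where
  "mdegree m = (\<Sum>v\<in>Poly_Mapping.keys m. Poly_Mapping.lookup m v)"

text \<open>Graded reverse lexicographic order on the monomials in the variables \<open>V\<close>, where \<open>r a b\<close>
  means \<open>x\<^sub>a < x\<^sub>b\<close>: in equal degree, the monomial with the larger exponent at the smallest
  variable at which the two differ is the smaller one.\<close>

definition grevlex :: "vertex set \<Rightarrow> (vertex \<Rightarrow> vertex \<Rightarrow> bool) \<Rightarrow> monom \<Rightarrow> monom \<Rightarrow> bool" where
  "grevlex V r m n \<longleftrightarrow> mdegree m < mdegree n \<or>
     (mdegree m = mdegree n \<and>
      (\<exists>a\<in>V. Poly_Mapping.lookup n a < Poly_Mapping.lookup m a \<and> (\<forall>b\<in>V. r b a \<longrightarrow> Poly_Mapping.lookup m b = Poly_Mapping.lookup n b)))"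

text \<open>In the following, \<open>ord\<close> is a strict monomial order; leading monomials and coefficients
  are meaningful for nonzero polynomials only.\<close>

definition lead_monom :: "(monom \<Rightarrow> monom \<Rightarrow> bool) \<Rightarrow> 'k::field mpoly \<Rightarrow> monom" where
  "lead_monom ord f = (THE m. m \<in> Poly_Mapping.keys f \<and> (\<forall>n\<in>Poly_Mapping.keys f. n \<noteq> m \<longrightarrow> ord n m))"

definition lead_coef :: "(monom \<Rightarrow> monom \<Rightarrow> bool) \<Rightarrow> 'k::field mpoly \<Rightarrow> 'k" where
  "lead_coef ord f = Poly_Mapping.lookup f (lead_monom ord f)"

definition initial_ideal ::
  "vertex set \<Rightarrow> (monom \<Rightarrow> monom \<Rightarrow> bool) \<Rightarrow> 'k::field mpoly set \<Rightarrow> 'k mpoly set" where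
  "initial_ideal V ord A = ideal_gen V ((\<lambda>f. monom_poly (lead_monom ord f)) ` (A - {0}))"

definition groebner_basis ::
  "vertex set \<Rightarrow> (monom \<Rightarrow> monom \<Rightarrow> bool) \<Rightarrow> 'k::field mpoly set \<Rightarrow> 'k mpoly set \<Rightarrow> bool" where
  "groebner_basis V ord I G \<longleftrightarrow>
     finite G \<and> 0 \<notin> G \<and> G \<subseteq> I \<and> initial_ideal V ord I = initial_ideal V ord G"

definition monom_dvd :: "monom \<Rightarrow> monom \<Rightarrow> bool" where
  "monom_dvd m n \<longleftrightarrow> (\<exists>l. n = m + l)"

definition reduced_groebner_basis ::
  "vertex set \<Rightarrow> (monom \<Rightarrow> monom \<Rightarrow> bool) \<Rightarrow> 'k::field mpoly set \<Rightarrow> 'k mpoly set \<Rightarrow> bool" where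
  "reduced_groebner_basis V ord I G \<longleftrightarrow> groebner_basis V ord I G \<and>
     (\<forall>g\<in>G. lead_coef ord g = 1) \<and>
     (\<forall>g\<in>G. \<forall>h\<in>G. h \<noteq> g \<longrightarrow> (\<forall>m\<in>Poly_Mapping.keys g. \<not> monom_dvd (lead_monom ord h) m))"

definition adjust_sign :: "(monom \<Rightarrow> monom \<Rightarrow> bool) \<Rightarrow> 'k::field mpoly \<Rightarrow> 'k mpoly" where
  "adjust_sign ord f = (if lead_coef ord f = 1 then f else - f)"

definition reduced_groebner_basis_up_to_sign ::
  "vertex set \<Rightarrow> (monom \<Rightarrow> monom \<Rightarrow> bool) \<Rightarrow> 'k::field mpoly set \<Rightarrow> 'k mpoly set \<Rightarrow> bool" where
  "reduced_groebner_basis_up_to_sign V ord I M \<longleftrightarrow>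
     reduced_groebner_basis V ord I (adjust_sign ord ` M)"


section \<open>Polyomino ideals\<close>

definition inner_minors :: "vertex set set \<Rightarrow> 'k::field mpoly set" where
  "inner_minors P = {var a * var b - var (upper_left a b) * var (lower_right a b) | a b.
     inner_interval P a b}"

definition polyomino_ideal :: "vertex set set \<Rightarrow> 'k::field mpoly set" where
  "polyomino_ideal P = ideal_gen (vertices P) (inner_minors P)"


section \<open>The eight vertex orders and their rotations\<close>

definition vless :: "nat \<Rightarrow> vertex \<Rightarrow> vertex \<Rightarrow> bool" where
  "vless i a b \<longleftrightarrow>
     i = 1 \<and> (fst a < fst b \<or> fst a = fst b \<and> snd a > snd b) \<or>
     i = 2 \<and> (fst a > fst b \<or> fst a = fst b \<and> snd a > snd b) \<or>
     i = 3 \<and> (fst a > fst b \<or> fst a = fst b \<and> snd a < snd b) \<or>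
     i = 4 \<and> (fst a < fst b \<or> fst a = fst b \<and> snd a < snd b) \<or>
     i = 5 \<and> (snd a < snd b \<or> snd a = snd b \<and> fst a > fst b) \<or>
     i = 6 \<and> (snd a < snd b \<or> snd a = snd b \<and> fst a < fst b) \<or>
     i = 7 \<and> (snd a > snd b \<or> snd a = snd b \<and> fst a < fst b) \<or>
     i = 8 \<and> (snd a > snd b \<or> snd a = snd b \<and> fst a > fst b)"

text \<open>The order \<open>v\<^sub>k < \<dots> < v\<^sub>n < v\<^sub>1 < \<dots> < v\<^bsub>k-1\<^esub>\<close> for \<open>v = v\<^sub>k\<close>: the vertices smaller than
  \<open>v\<close> are moved above all others. The lemma below relates it to the enumeration.\<close>

definition vless_from :: "nat \<Rightarrow> vertex \<Rightarrow> vertex \<Rightarrow> vertex \<Rightarrow> bool" where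
  "vless_from i v a b \<longleftrightarrow>
     (if vless i a v \<longleftrightarrow> vless i b v then vless i a b else vless i b v)"

lemma vless_asym: "vless i a b \<Longrightarrow> \<not> vless i b a"
  unfolding vless_def by (elim disjE conjE) simp_all

lemma vless_from_rotate:
  assumes "sorted_wrt (vless i) vs" and "k < length vs"
  shows "sorted_wrt (vless_from i (vs ! k)) (rotate k vs)"
proof -
  let ?v = "vs ! k"
  have less: "vless i (vs ! s) (vs ! t)" if "s < t" "t < length vs" for s t
    using assms(1) that by (simp add: sorted_wrt_iff_nth_less)
  have below: "vless i (vs ! s) ?v \<longleftrightarrow> s < k" if "s < length vs" for s
    using less[of s k] less[of k s] that assms(2) vless_asym
    by (metis linorder_neqE_nat)
  have drop_below: "\<not> vless i a ?v" if "a \<in> set (drop k vs)" for a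
    using that below by (auto simp: in_set_conv_nth)
  have take_below: "vless i a ?v" if "a \<in> set (take k vs)" for a
    using that below assms(2) by (auto simp: in_set_conv_nth)
  have "sorted_wrt (vless_from i ?v) (drop k vs)"
    by (rule sorted_wrt_mono_rel[OF _ sorted_wrt_drop[OF assms(1)]])
       (simp add: vless_from_def drop_below)
  moreover have "sorted_wrt (vless_from i ?v) (take k vs)"
    by (rule sorted_wrt_mono_rel[OF _ sorted_wrt_take[OF assms(1)]])
       (simp add: vless_from_def take_below)
  ultimately show ?thesis
    using assms(2)
    by (auto simp: rotate_drop_take sorted_wrt_append vless_from_def drop_below take_below)
qed

definition grevlex_std :: "vertex set set \<Rightarrow> nat \<Rightarrow> monom \<Rightarrow> monom \<Rightarrow> bool" where
  "grevlex_std P i = grevlex (vertices P) (vless i)"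

definition grevlex_from :: "vertex set set \<Rightarrow> nat \<Rightarrow> vertex \<Rightarrow> monom \<Rightarrow> monom \<Rightarrow> bool" where
  "grevlex_from P i v = grevlex (vertices P) (vless_from i v)"


section \<open>The conditions on a vertex\<close>

datatype quadrant = LL | LR | UL | UR

fun quadrant_inner ::
  "vertex set set \<Rightarrow> nat \<Rightarrow> nat \<Rightarrow> nat \<Rightarrow> nat \<Rightarrow> nat \<Rightarrow> nat \<Rightarrow> quadrant \<Rightarrow> bool" where
  "quadrant_inner P x0 x1 x2 y0 y1 y2 LL = inner_interval P (x0, y0) (x1, y1)"
| "quadrant_inner P x0 x1 x2 y0 y1 y2 LR = inner_interval P (x1, y0) (x2, y1)"
| "quadrant_inner P x0 x1 x2 y0 y1 y2 UL = inner_interval P (x0, y1) (x1, y2)"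
| "quadrant_inner P x0 x1 x2 y0 y1 y2 UR = inner_interval P (x1, y1) (x2, y2)"

text \<open>Coordinates may be taken in \<open>\<nat>\<close>: any three of the four quadrants are intervals of
  \<open>\<nat>\<^sup>2\<close> involving all six coordinates.\<close>

definition satisfies_pi :: "vertex set set \<Rightarrow> nat \<Rightarrow> vertex \<Rightarrow> bool" where
  "satisfies_pi P i v \<longleftrightarrow> (\<exists>x0 x1 x2 y0 y1 y2. x0 < x1 \<and> x1 < x2 \<and> y0 < y1 \<and> y1 < y2 \<and>
     (let missing = (\<lambda>X. \<not> quadrant_inner P x0 x1 x2 y0 y1 y2 X \<and>
                         (\<forall>Y. Y \<noteq> X \<longrightarrow> quadrant_inner P x0 x1 x2 y0 y1 y2 Y))
      in i = 1 \<and> (missing LR \<and> v = (x0, y1) \<or> missing LL \<and> v = (x1, y1)) \<or>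
         i = 2 \<and> (missing LL \<and> v = (x2, y1) \<or> missing LR \<and> v = (x1, y1)) \<or>
         i = 3 \<and> (missing UL \<and> v = (x2, y1) \<or> missing UR \<and> v = (x1, y1)) \<or>
         i = 4 \<and> (missing UR \<and> v = (x0, y1) \<or> missing UL \<and> v = (x1, y1)) \<or>
         i = 5 \<and> (missing UL \<and> v = (x1, y0) \<or> missing LL \<and> v = (x1, y1)) \<or>
         i = 6 \<and> (missing UR \<and> v = (x1, y0) \<or> missing LR \<and> v = (x1, y1)) \<or>
         i = 7 \<and> (missing LR \<and> v = (x1, y2) \<or> missing UR \<and> v = (x1, y1)) \<or>
         i = 8 \<and> (missing LL \<and> v = (x1, y2) \<or> missing UL \<and> v = (x1, y1))))"

end

theory Submission
  imports Defs
begin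

text \<open>
  A Groebner basis consisting of differences of monomials is a matter of rewriting. Replacing
  leading monomials by the corresponding trailing ones is a terminating relation on monomials, and
  local confluence of this relation implies that the binomials form a Groebner basis
  (\<open>groebner_basis_if_locally_confluent\<close>). Since the leading monomials of inner 2-minors have
  degree 2 and determine the minor, reducedness is automatic.

  Every one of the eight orders is lexicographic for a suitable choice of columns and rows, each
  ordered increasingly or decreasingly. The condition on \<open>v\<close> is the same for all eight of them when
  expressed in these terms. Rotating the order at \<open>v\<close> rotates the order of the columns within each
  row, by one column more in the rows before that of \<open>v\<close> than in the others. In all cases, an
  inner interval with rows \<open>y < y'\<close> and columns \<open>x, x'\<close> gives the rule
  \<open>(x, y') (x', y) \<rightarrow> (x, y) (x', y')\<close>, where \<open>x\<close> precedes \<open>x'\<close> in the order belonging to the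
  lower row \<open>y\<close>.

  For the order before the rotation, sorting an antidiagonal of three vertices in two ways
  shows that a Groebner basis forces a combinatorial condition on \<open>P\<close>
  (\<open>corner_condition_if_groebner_basis\<close>): if a horizontal and a vertical line divide a
  rectangle into four quadrants and two opposite ones, on the diagonal belonging to the order, are
  inner intervals, then so is one of the other two. The order enters only through this diagonal,
  that is, through the parity of its index.

  Conversely, two rules overlap in a lower vertex, in an upper vertex, or in a vertex which is lower
  for one and upper for the other. The exchange of the two diagonals of an inner interval
  is a step in one of the two directions, whatever the order is. Being inner is moreover
  transitive in the columns: if \<open>x, x'\<close> and \<open>x', x''\<close> bound inner intervals in the same rows, then
  so do \<open>x, x''\<close>. This resolves almost all overlaps; the corner
  condition is needed for those of the third kind. In the remaining cases the column of \<open>v\<close> changes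
  its position between two of the rows involved, and the failing intervals would be precisely those
  which are excluded by the hypothesis on \<open>v\<close> (\<open>no_pi\<close>).
\<close>

section \<open>Polynomials over a set of variables and their ideals\<close>

lemma poly_ring_zero [simp]: "0 \<in> poly_ring V"
  by (simp add: poly_ring_def)

lemma poly_ring_one [simp]: "1 \<in> poly_ring V"
  by (simp add: poly_ring_def)

lemma poly_ring_add: "p \<in> poly_ring V \<Longrightarrow> q \<in> poly_ring V \<Longrightarrow> p + q \<in> poly_ring V"
  unfolding poly_ring_def using keys_add[of p q] by blast

lemma poly_ring_uminus [simp]: "- p \<in> poly_ring V \<longleftrightarrow> p \<in> poly_ring V"
  by (simp add: poly_ring_def)

lemma poly_ring_diff: "p \<in> poly_ring V \<Longrightarrow> q \<in> poly_ring V \<Longrightarrow> p - q \<in> poly_ring V"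
  using poly_ring_add[of p V "- q"] by simp

lemma poly_ring_mult:
  assumes "p \<in> poly_ring V" "q \<in> poly_ring V" shows "p * q \<in> poly_ring V"
  unfolding poly_ring_def
proof (intro CollectI ballI)
  fix m assume "m \<in> Poly_Mapping.keys (p * q)"
  then obtain a b where "m = a + b" "a \<in> Poly_Mapping.keys p" "b \<in> Poly_Mapping.keys q"
    using keys_mult[of p q] by auto
  then show "Poly_Mapping.keys m \<subseteq> V"
    using keys_add[of a b] assms unfolding poly_ring_def by blast
qed

lemma poly_ring_sum: "(\<And>x. x \<in> A \<Longrightarrow> f x \<in> poly_ring V) \<Longrightarrow> sum f A \<in> poly_ring V"
  by (induction A rule: infinite_finite_induct) (simp_all add: poly_ring_add)

lemma poly_ring_monom_poly [simp]: "monom_poly m \<in> poly_ring V \<longleftrightarrow> Poly_Mapping.keys m \<subseteq> V"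
  by (simp add: poly_ring_def monom_poly_def)

lemma monom_poly_mult: "monom_poly m * monom_poly n = monom_poly (m + n)"
  by (simp add: monom_poly_def mult_single)

lemma lookup_monom_poly: "Poly_Mapping.lookup (monom_poly m) n = (if n = m then 1 else 0)"
  by (auto simp: monom_poly_def lookup_single)

lemma ideal_gen_memI:
  assumes "finite F" "F \<subseteq> A" "\<And>g. g \<in> F \<Longrightarrow> q g \<in> poly_ring V" "f = (\<Sum>g\<in>F. q g * g)"
  shows "f \<in> ideal_gen V A"
  using assms unfolding ideal_gen_def by blast

lemma ideal_gen_memE:
  assumes "f \<in> ideal_gen V A"
  obtains F q where "finite F" "F \<subseteq> A" "\<forall>g\<in>F. q g \<in> poly_ring V" "f = (\<Sum>g\<in>F. q g * g)"
  using assms unfolding ideal_gen_def by blast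

lemma ideal_gen_zero [simp]: "0 \<in> ideal_gen V A"
  by (rule ideal_gen_memI[of "{}" _ "\<lambda>_. 0"]) simp_all

lemma ideal_gen_generator: "g \<in> A \<Longrightarrow> g \<in> ideal_gen V A"
  by (rule ideal_gen_memI[of "{g}" _ "\<lambda>_. 1"]) simp_all

lemma ideal_gen_add:
  assumes "f \<in> ideal_gen V A" "h \<in> ideal_gen V A" shows "f + h \<in> ideal_gen V A"
proof -
  obtain F q where F: "finite F" "F \<subseteq> A" "\<forall>g\<in>F. q g \<in> poly_ring V"
    "f = (\<Sum>g\<in>F. q g * g)" using assms(1) by (rule ideal_gen_memE)
  obtain H p where H: "finite H" "H \<subseteq> A" "\<forall>g\<in>H. p g \<in> poly_ring V"
    "h = (\<Sum>g\<in>H. p g * g)" using assms(2) by (rule ideal_gen_memE)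
  define q' where "q' g = (if g \<in> F then q g else 0)" for g
  define p' where "p' g = (if g \<in> H then p g else 0)" for g
  have "f = (\<Sum>g\<in>F \<union> H. q' g * g)" "h = (\<Sum>g\<in>F \<union> H. p' g * g)"
    unfolding F(4) H(4) using F(1) H(1)
    by (auto simp: q'_def p'_def intro!: sum.mono_neutral_cong_left)
  then have "f + h = (\<Sum>g\<in>F \<union> H. (q' g + p' g) * g)"
    by (simp add: sum.distrib distrib_right)
  then show ?thesis
    using F H by (intro ideal_gen_memI[of "F \<union> H" _ "\<lambda>g. q' g + p' g"])
      (auto simp: q'_def p'_def intro!: poly_ring_add)
qed

lemma ideal_gen_mult:
  assumes "p \<in> poly_ring V" "f \<in> ideal_gen V A" shows "p * f \<in> ideal_gen V A"
proof -
  obtain F q where F: "finite F" "F \<subseteq> A" "\<forall>g\<in>F. q g \<in> poly_ring V"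
    "f = (\<Sum>g\<in>F. q g * g)" using assms(2) by (rule ideal_gen_memE)
  show ?thesis
    using F assms(1) by (intro ideal_gen_memI[of F _ "\<lambda>g. p * q g"])
      (auto simp: sum_distrib_left mult.assoc intro: poly_ring_mult)
qed

lemma ideal_gen_uminus: "f \<in> ideal_gen V A \<Longrightarrow> - f \<in> ideal_gen V A"
  using ideal_gen_mult[of "- 1" V f A] by simp

lemma ideal_gen_diff: "f \<in> ideal_gen V A \<Longrightarrow> h \<in> ideal_gen V A \<Longrightarrow> f - h \<in> ideal_gen V A"
  using ideal_gen_add[of f V A "- h"] ideal_gen_uminus[of h V A] by simp

lemma ideal_gen_least:
  assumes "A \<subseteq> ideal_gen V B" shows "ideal_gen V A \<subseteq> ideal_gen V B"
proof
  fix f assume "f \<in> ideal_gen V A"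
  then obtain F q where F: "finite F" "F \<subseteq> A" "\<forall>g\<in>F. q g \<in> poly_ring V"
    "f = (\<Sum>g\<in>F. q g * g)" by (rule ideal_gen_memE)
  have "(\<Sum>g\<in>H. q g * g) \<in> ideal_gen V B" if "H \<subseteq> F" for H
    using finite_subset[OF that F(1)] that
    by (induction H) (use F assms in \<open>auto intro!: ideal_gen_add ideal_gen_mult\<close>)
  then show "f \<in> ideal_gen V B" using F(4) by simp
qed

lemma ideal_gen_subset_poly_ring:
  "A \<subseteq> poly_ring V \<Longrightarrow> ideal_gen V A \<subseteq> poly_ring V"
  by (auto elim!: ideal_gen_memE intro!: poly_ring_sum poly_ring_mult)

lemma keys_monomial_ideal:
  assumes "f \<in> ideal_gen V (monom_poly ` L)" "m \<in> Poly_Mapping.keys f"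
  shows "\<exists>l\<in>L. monom_dvd l m"
proof -
  obtain F q where F: "F \<subseteq> monom_poly ` L" "f = (\<Sum>g\<in>F. q g * g)"
    using assms(1) by (rule ideal_gen_memE)
  then obtain l where "l \<in> L" "m \<in> Poly_Mapping.keys (q (monom_poly l) * monom_poly l)"
    using assms(2) keys_sum[of "\<lambda>g. q g * g" F] by blast
  then obtain a where "m = a + l"
    using keys_mult[of "q (monom_poly l)" "monom_poly l"]
    by (auto simp: monom_poly_def)
  then show ?thesis using \<open>l \<in> L\<close> unfolding monom_dvd_def by (metis add.commute)
qed


section \<open>Ideals generated by differences of monomials\<close>

text \<open>The sum of the coefficients of \<open>f\<close> at the monomials of \<open>S\<close>: a linear functional that
  vanishes on an ideal generated by differences \<open>l - t\<close> of monomials as soon as \<open>S\<close> is a union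
  of classes of the congruence generated by the pairs \<open>(l, t)\<close>.\<close>

definition coeff_sum :: "monom set \<Rightarrow> 'k::field mpoly \<Rightarrow> 'k" where
  "coeff_sum S f = (\<Sum>n\<in>Poly_Mapping.keys f. if n \<in> S then Poly_Mapping.lookup f n else 0)"

lemma coeff_sum_superset:
  assumes "finite A" "Poly_Mapping.keys f \<subseteq> A"
  shows "coeff_sum S f = (\<Sum>n\<in>A. if n \<in> S then Poly_Mapping.lookup f n else 0)"
  unfolding coeff_sum_def using assms
  by (intro sum.mono_neutral_left) (auto simp: in_keys_iff)

lemma coeff_sum_zero [simp]: "coeff_sum S 0 = 0"
  by (simp add: coeff_sum_def)

lemma coeff_sum_add: "coeff_sum S (f + g) = coeff_sum S f + coeff_sum S g"
proof -
  let ?A = "Poly_Mapping.keys f \<union> Poly_Mapping.keys g"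
  have "finite ?A" "Poly_Mapping.keys (f + g) \<subseteq> ?A" using keys_add[of f g] by auto
  then show ?thesis
    using coeff_sum_superset[of ?A "f + g" S] coeff_sum_superset[of ?A f S]
      coeff_sum_superset[of ?A g S]
    by (auto simp: sum.distrib[symmetric] lookup_add intro!: sum.cong)
qed

lemma coeff_sum_uminus: "coeff_sum S (- f) = - coeff_sum S f"
  by (simp add: coeff_sum_def sum_negf[symmetric] if_distrib cong: if_cong)

lemma coeff_sum_diff: "coeff_sum S (f - g) = coeff_sum S f - coeff_sum S g"
  using coeff_sum_add[of S f "- g"] by (simp add: coeff_sum_uminus)

lemma coeff_sum_sum: "coeff_sum S (sum f A) = (\<Sum>x\<in>A. coeff_sum S (f x))"
  by (induction A rule: infinite_finite_induct) (simp_all add: coeff_sum_add)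

lemma coeff_sum_single: "coeff_sum S (Poly_Mapping.single m c) = (if m \<in> S then c else 0)"
  by (simp add: coeff_sum_def)

lemma poly_mapping_eq_sum_single:
  fixes q :: "'a \<Rightarrow>\<^sub>0 'b::comm_monoid_add"
  shows "q = (\<Sum>u\<in>Poly_Mapping.keys q. Poly_Mapping.single u (Poly_Mapping.lookup q u))"
  by (rule poly_mapping_eqI) (auto simp: lookup_sum lookup_single when_def in_keys_iff)

lemma coeff_sum_mult_diff:
  assumes "\<And>u. u + l \<in> S \<longleftrightarrow> u + t \<in> S"
  shows "coeff_sum S (q * (monom_poly l - monom_poly t)) = 0"
proof -
  have "q * (monom_poly l - monom_poly t) =
    (\<Sum>u\<in>Poly_Mapping.keys q. Poly_Mapping.single (u + l) (Poly_Mapping.lookup q u)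
       - Poly_Mapping.single (u + t) (Poly_Mapping.lookup q u))"
    by (subst poly_mapping_eq_sum_single[of q])
      (simp add: sum_distrib_right right_diff_distrib monom_poly_def mult_single sum_subtractf)
  then show ?thesis
    using assms by (simp add: coeff_sum_sum coeff_sum_diff coeff_sum_single)
qed

lemma coeff_sum_ideal_eq_zero:
  assumes "f \<in> ideal_gen V B"
    and "\<And>g. g \<in> B \<Longrightarrow> \<exists>l t. g = monom_poly l - monom_poly t \<and> (\<forall>u. u + l \<in> S \<longleftrightarrow> u + t \<in> S)"
  shows "coeff_sum S f = 0"
proof -
  obtain F q where F: "F \<subseteq> B" "f = (\<Sum>g\<in>F. q g * g)"
    using assms(1) by (rule ideal_gen_memE)
  have "coeff_sum S (q g * g) = 0" if g: "g \<in> B" for g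
  proof -
    obtain l t where "g = monom_poly l - monom_poly t" "\<And>u. u + l \<in> S \<longleftrightarrow> u + t \<in> S"
      using assms(2)[OF g] by blast
    then show ?thesis using coeff_sum_mult_diff[of l S t "q g"] by simp
  qed
  then show ?thesis using F by (auto simp: coeff_sum_sum intro!: sum.neutral)
qed


section \<open>The graded reverse lexicographic order\<close>

lemma mdegree_superset:
  assumes "finite A" "Poly_Mapping.keys m \<subseteq> A"
  shows "mdegree m = (\<Sum>v\<in>A. Poly_Mapping.lookup m v)"
  unfolding mdegree_def using assms
  by (intro sum.mono_neutral_left) (auto simp: in_keys_iff)

lemma mdegree_add: "mdegree (m + n) = mdegree m + mdegree n"
proof -
  let ?A = "Poly_Mapping.keys m \<union> Poly_Mapping.keys n"
  have "finite ?A" "Poly_Mapping.keys (m + n) \<subseteq> ?A" using keys_add[of m n] by auto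
  then show ?thesis
    using mdegree_superset[of ?A "m + n"] mdegree_superset[of ?A m] mdegree_superset[of ?A n]
    by (simp add: sum.distrib lookup_add)
qed

lemma mdegree_single [simp]: "mdegree (Poly_Mapping.single v k) = k"
  by (simp add: mdegree_def)

lemma mdegree_eq_0_iff: "mdegree m = 0 \<longleftrightarrow> m = 0"
  by (auto simp: mdegree_def in_keys_iff intro!: poly_mapping_eqI)

lemma finite_monoms_of_degree:
  assumes "finite V"
  shows "finite {m. Poly_Mapping.keys m \<subseteq> V \<and> mdegree m = d}"
proof (rule inj_on_finite)
  show "inj_on Poly_Mapping.lookup {m. Poly_Mapping.keys m \<subseteq> V \<and> mdegree m = d}"
    by (simp add: inj_on_def)
  show "Poly_Mapping.lookup ` {m. Poly_Mapping.keys m \<subseteq> V \<and> mdegree m = d}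
    \<subseteq> {f. \<forall>x. (x \<in> V \<longrightarrow> f x \<in> {..d}) \<and> (x \<notin> V \<longrightarrow> f x = 0)}"
  proof clarsimp
    fix m :: monom and x :: vertex assume m: "Poly_Mapping.keys m \<subseteq> V"
    show "(x \<in> V \<longrightarrow> Poly_Mapping.lookup m x \<le> mdegree m) \<and> (x \<notin> V \<longrightarrow> Poly_Mapping.lookup m x = 0)"
      using m mdegree_superset[OF assms m] member_le_sum[of x V "Poly_Mapping.lookup m"] assms
      by (auto simp: in_keys_iff)
  qed
  show "finite {f. \<forall>x. (x \<in> V \<longrightarrow> f x \<in> {..d}) \<and> (x \<notin> V \<longrightarrow> f x = (0::nat))}"
    by (rule finite_set_of_finite_funs) (use assms in auto)
qed

text \<open>A graded reverse lexicographic order on monomials. As a function it is defined on all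
  monomials, but it is total on those in the variables \<open>V\<close> only.\<close>

locale grevlex_order =
  fixes V :: "vertex set" and r :: "vertex \<Rightarrow> vertex \<Rightarrow> bool"
  assumes finite_V: "finite V"
    and r_irrefl: "\<not> r a a"
    and r_trans: "r a b \<Longrightarrow> r b c \<Longrightarrow> r a c"
    and r_total: "a \<noteq> b \<Longrightarrow> r a b \<or> r b a"
begin

abbreviation ord :: "monom \<Rightarrow> monom \<Rightarrow> bool" where
  "ord \<equiv> grevlex V r"

lemma ord_irrefl: "\<not> ord m m"
  by (simp add: grevlex_def)

lemma ord_trans:
  assumes "ord m n" "ord n p" shows "ord m p"
proof (cases "mdegree m < mdegree p")
  case False
  with assms have deg: "mdegree m = mdegree n" "mdegree n = mdegree p"
    by (auto simp: grevlex_def)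
  obtain a where a: "a \<in> V" "Poly_Mapping.lookup n a < Poly_Mapping.lookup m a"
    "\<And>b. b \<in> V \<Longrightarrow> r b a \<Longrightarrow> Poly_Mapping.lookup m b = Poly_Mapping.lookup n b"
    using assms(1) deg by (auto simp: grevlex_def)
  obtain c where c: "c \<in> V" "Poly_Mapping.lookup p c < Poly_Mapping.lookup n c"
    "\<And>b. b \<in> V \<Longrightarrow> r b c \<Longrightarrow> Poly_Mapping.lookup n b = Poly_Mapping.lookup p b"
    using assms(2) deg by (auto simp: grevlex_def)
  obtain e where e: "e \<in> V" "Poly_Mapping.lookup p e < Poly_Mapping.lookup m e"
    "\<And>b. r b e \<Longrightarrow> r b a" "\<And>b. r b e \<Longrightarrow> r b c"
  proof -
    consider "r a c" | "r c a" | "a = c" using r_total by blast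
    then show thesis
    proof cases
      case 1
      then show thesis using that[of a] a c(3)[of a] r_trans[OF _ 1] by simp
    next
      case 2
      then show thesis using that[of c] c a(3)[of c] r_trans[OF _ 2] by simp
    next
      case 3
      then show thesis using that[of a] a c by simp
    qed
  qed
  then have "\<forall>b\<in>V. r b e \<longrightarrow> Poly_Mapping.lookup m b = Poly_Mapping.lookup p b"
    using a(3) c(3) by simp
  then show ?thesis using e(1,2) deg unfolding grevlex_def by auto
qed (simp add: grevlex_def)

lemma ord_total:
  assumes "Poly_Mapping.keys m \<subseteq> V" "Poly_Mapping.keys n \<subseteq> V" "m \<noteq> n"
  shows "ord m n \<or> ord n m"
proof (cases "mdegree m = mdegree n")
  case True
  let ?D = "{a \<in> V. Poly_Mapping.lookup m a \<noteq> Poly_Mapping.lookup n a}"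
  have "?D \<noteq> {}"
  proof
    assume "?D = {}"
    then have eq: "Poly_Mapping.lookup m a = Poly_Mapping.lookup n a" if "a \<in> V" for a
      using that by blast
    have "Poly_Mapping.lookup m a = Poly_Mapping.lookup n a" for a
    proof (cases "a \<in> V")
      case False
      then have "a \<notin> Poly_Mapping.keys m" "a \<notin> Poly_Mapping.keys n" using assms(1,2) by auto
      then show ?thesis by (simp add: in_keys_iff)
    qed (rule eq)
    then show False using assms(3) by (simp add: poly_mapping_eqI)
  qed
  moreover have "finite ?D" using finite_V by simp
  moreover have "asymp_on ?D r"
    by (rule asymp_onI) (metis r_trans r_irrefl)
  moreover have "transp_on ?D r"
    by (rule transp_onI) (rule r_trans)
  ultimately obtain a where a: "a \<in> ?D" "\<forall>b\<in>?D. b \<noteq> a \<longrightarrow> \<not> r b a"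
    using Finite_Set.bex_min_element[of ?D r] by blast
  have "\<forall>b\<in>V. r b a \<longrightarrow> Poly_Mapping.lookup m b = Poly_Mapping.lookup n b"
  proof (intro ballI impI)
    fix b assume "b \<in> V" "r b a"
    then show "Poly_Mapping.lookup m b = Poly_Mapping.lookup n b"
      using a(2) r_irrefl[of a] by fastforce
  qed
  moreover from this have "\<forall>b\<in>V. r b a \<longrightarrow> Poly_Mapping.lookup n b = Poly_Mapping.lookup m b"
    by simp
  moreover have "a \<in> V" using a(1) by blast
  moreover have "Poly_Mapping.lookup m a < Poly_Mapping.lookup n a \<or>
    Poly_Mapping.lookup n a < Poly_Mapping.lookup m a" using a(1) by auto
  ultimately show ?thesis unfolding grevlex_def True by blast
qed (auto simp: grevlex_def)

lemma ord_add: "ord m n \<Longrightarrow> ord (m + w) (n + w)"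
  by (auto simp: grevlex_def mdegree_add lookup_add)

text \<open>A product of two variables, one of which is smaller than both \<open>p'\<close> and \<open>q'\<close>, is smaller than
  the product of \<open>p'\<close> and \<open>q'\<close>.\<close>

lemma ord_pair:
  assumes "{p, q, p', q'} \<subseteq> V" and "a \<in> {p, q}" "r a p'" "r a q'"
  shows "ord (Poly_Mapping.single p 1 + Poly_Mapping.single q 1)
    (Poly_Mapping.single p' 1 + Poly_Mapping.single q' 1)"
proof -
  obtain e where e: "e \<in> {p, q}" "r e p'" "r e q'" "\<And>b. r b e \<Longrightarrow> b \<noteq> p \<and> b \<noteq> q"
  proof -
    consider "p = q" | "r p q" | "r q p" using r_total by blast
    then show thesis
    proof cases
      case 1
      then show thesis using that[of p] assms(2-4) r_irrefl by blast
    next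
      case 2
      then have "r p p'" "r p q'" using assms(2-4) r_trans by blast+
      then show thesis using that[of p] 2 r_trans r_irrefl by blast
    next
      case 3
      then have "r q p'" "r q q'" using assms(2-4) r_trans by blast+
      then show thesis using that[of q] 3 r_trans r_irrefl by blast
    qed
  qed
  have "b \<noteq> p' \<and> b \<noteq> q'" if "r b e" for b
    using that e(2,3) r_trans r_irrefl by blast
  moreover have "e \<noteq> p'" "e \<noteq> q'" using e(2,3) r_irrefl[of e] by auto
  moreover have "e \<in> V" using e(1) assms(1) by blast
  ultimately show ?thesis
    using e(1,4) by (auto simp: grevlex_def mdegree_add lookup_add lookup_single when_def
      intro!: bexI[of _ e])
qed

lemma lead_monom_eqI:
  assumes "m \<in> Poly_Mapping.keys f" "\<And>n. n \<in> Poly_Mapping.keys f \<Longrightarrow> n \<noteq> m \<Longrightarrow> ord n m"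
  shows "lead_monom ord f = m"
  unfolding lead_monom_def
proof (rule the_equality)
  fix n assume n: "n \<in> Poly_Mapping.keys f \<and> (\<forall>n'\<in>Poly_Mapping.keys f. n' \<noteq> n \<longrightarrow> ord n' n)"
  show "n = m"
  proof (rule ccontr)
    assume "n \<noteq> m"
    then have "ord n m" "ord m n" using n assms by auto
    then show False using ord_trans[of n m n] ord_irrefl by simp
  qed
qed (use assms in auto)

lemma lead_monom_greatest:
  assumes "f \<in> poly_ring V" "f \<noteq> 0"
  shows "lead_monom ord f \<in> Poly_Mapping.keys f"
    and "n \<in> Poly_Mapping.keys f \<Longrightarrow> n \<noteq> lead_monom ord f \<Longrightarrow> ord n (lead_monom ord f)"
proof -
  have "\<exists>g\<in>Poly_Mapping.keys f. \<forall>x\<in>Poly_Mapping.keys f. x \<noteq> g \<longrightarrow> ord x g"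
  proof (rule Finite_Set.bex_greatest_element)
    show "transp_on (Poly_Mapping.keys f) ord"
      by (rule transp_onI) (rule ord_trans)
    show "totalp_on (Poly_Mapping.keys f) ord"
      using ord_total assms(1) unfolding poly_ring_def by (intro totalp_onI) blast
  qed (use assms(2) in auto)
  then obtain g where g: "g \<in> Poly_Mapping.keys f" "\<forall>x\<in>Poly_Mapping.keys f. x \<noteq> g \<longrightarrow> ord x g"
    by blast
  then have "lead_monom ord f = g" by (intro lead_monom_eqI) auto
  with g show "lead_monom ord f \<in> Poly_Mapping.keys f"
    "n \<in> Poly_Mapping.keys f \<Longrightarrow> n \<noteq> lead_monom ord f \<Longrightarrow> ord n (lead_monom ord f)" by auto
qed

lemma lead_monom_binomial:
  assumes "ord t l"
  shows "lead_monom ord (monom_poly l - monom_poly t :: 'k::field mpoly) = l"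
    and "lead_monom ord (monom_poly t - monom_poly l :: 'k mpoly) = l"
  using assms ord_irrefl[of l]
  by (auto intro!: lead_monom_eqI simp: in_keys_iff lookup_minus lookup_monom_poly split: if_splits)

end

section \<open>Rewriting of monomials and Groebner bases of binomials\<close>

text \<open>One rewriting step replaces a factor \<open>l\<close> of a monomial by \<open>t\<close>, for a pair \<open>(l, t)\<close> in \<open>R\<close>.\<close>

definition step :: "(monom \<times> monom) set \<Rightarrow> monom \<Rightarrow> monom \<Rightarrow> bool" where
  "step R m n \<longleftrightarrow> (\<exists>l t w. (l, t) \<in> R \<and> m = l + w \<and> n = t + w)"

text \<open>Two monomials are joinable if they can be rewritten to the same monomial.\<close>

definition joinable :: "(monom \<times> monom) set \<Rightarrow> monom \<Rightarrow> monom \<Rightarrow> bool" where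
  "joinable R m n \<longleftrightarrow> (\<exists>z. (step R)\<^sup>*\<^sup>* m z \<and> (step R)\<^sup>*\<^sup>* n z)"

lemma step_add:
  assumes "step R m n" shows "step R (m + w) (n + w)"
proof -
  obtain l t u where "(l, t) \<in> R" "m = l + u" "n = t + u" using assms unfolding step_def by blast
  then have "(l, t) \<in> R \<and> m + w = l + (u + w) \<and> n + w = t + (u + w)" by (simp add: add.assoc)
  then show ?thesis unfolding step_def by blast
qed

lemma steps_add: "(step R)\<^sup>*\<^sup>* m n \<Longrightarrow> (step R)\<^sup>*\<^sup>* (m + w) (n + w)"
  by (induction rule: rtranclp_induct) (auto intro: rtranclp.rtrancl_into_rtrancl step_add)

lemma joinable_add: "joinable R m n \<Longrightarrow> joinable R (m + w) (n + w)"
  unfolding joinable_def using steps_add by blast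

lemma joinable_sym: "joinable R m n \<Longrightarrow> joinable R n m"
  unfolding joinable_def by blast

lemma joinable_step_left:
  assumes "step R m m'" "joinable R m' n" shows "joinable R m n"
  using assms unfolding joinable_def by (meson converse_rtranclp_into_rtranclp)

lemma joinable_step_right:
  assumes "step R n n'" "joinable R m n'" shows "joinable R m n"
  using assms joinable_step_left joinable_sym by blast

lemma joinable_refl [simp]: "joinable R m m"
  unfolding joinable_def by blast

lemma newman:
  assumes wf: "wfP (\<lambda>n m. S m n)"
    and local: "\<And>m p q. S m p \<Longrightarrow> S m q \<Longrightarrow> \<exists>z. S\<^sup>*\<^sup>* p z \<and> S\<^sup>*\<^sup>* q z"
  shows "S\<^sup>*\<^sup>* m p \<Longrightarrow> S\<^sup>*\<^sup>* m q \<Longrightarrow> \<exists>z. S\<^sup>*\<^sup>* p z \<and> S\<^sup>*\<^sup>* q z"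
proof (induction m arbitrary: p q rule: wfp_induct_rule[OF wf])
  case (1 m)
  show ?case
  proof (cases "m = p \<or> m = q")
    case True
    then show ?thesis using 1(2,3) by blast
  next
    case False
    then obtain p1 q1 where p1: "S m p1" "S\<^sup>*\<^sup>* p1 p" and q1: "S m q1" "S\<^sup>*\<^sup>* q1 q"
      using 1(2,3) by (metis converse_rtranclpE)
    obtain z where z: "S\<^sup>*\<^sup>* p1 z" "S\<^sup>*\<^sup>* q1 z" using local p1(1) q1(1) by blast
    obtain y where y: "S\<^sup>*\<^sup>* p y" "S\<^sup>*\<^sup>* z y" using 1(1)[OF p1(1) p1(2) z(1)] by blast
    have "S\<^sup>*\<^sup>* q1 y" using z(2) y(2) by (rule rtranclp_trans)
    then obtain x where "S\<^sup>*\<^sup>* q x" "S\<^sup>*\<^sup>* y x" using 1(1)[OF q1(1) q1(2)] by blast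
    then show ?thesis using y(1) by (meson rtranclp_trans)
  qed
qed

text \<open>The pairs \<open>(l, t)\<close> of \<open>R\<close> are the leading and the trailing monomials of the binomials
  in \<open>B\<close>, whose signs are arbitrary.\<close>

locale binomial_rewriting = grevlex_order V r for V r +
  fixes R :: "(monom \<times> monom) set" and B :: "'k::field mpoly set"
  assumes finite_R: "finite R"
    and R_keys: "(l, t) \<in> R \<Longrightarrow> Poly_Mapping.keys l \<subseteq> V \<and> Poly_Mapping.keys t \<subseteq> V"
    and R_ord: "(l, t) \<in> R \<Longrightarrow> ord t l"
    and B_binomial: "g \<in> B \<Longrightarrow> \<exists>l t. (l, t) \<in> R \<and>
      (g = monom_poly l - monom_poly t \<or> g = monom_poly t - monom_poly l)"
    and R_binomial: "(l, t) \<in> R \<Longrightarrow>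
      monom_poly l - monom_poly t \<in> B \<or> monom_poly t - monom_poly l \<in> B"
begin

text \<open>The binomials with leading coefficient 1.\<close>

definition binomials :: "'k mpoly set" where
  "binomials = {monom_poly l - monom_poly t | l t. (l, t) \<in> R}"

lemma R_neq: "(l, t) \<in> R \<Longrightarrow> l \<noteq> t"
  using R_ord ord_irrefl by blast

lemma lead_coef_binomial:
  assumes "ord t l"
  shows "lead_coef ord (monom_poly l - monom_poly t :: 'k mpoly) = 1"
    and "lead_coef ord (monom_poly t - monom_poly l :: 'k mpoly) = - 1"
  using assms ord_irrefl[of l] lead_monom_binomial[OF assms, where 'k = 'k]
  by (auto simp: lead_coef_def lookup_minus lookup_monom_poly)

lemma adjust_sign_binomial:
  assumes "ord t l"
  shows "adjust_sign ord (monom_poly l - monom_poly t :: 'k mpoly) = monom_poly l - monom_poly t"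
    and "adjust_sign ord (monom_poly t - monom_poly l :: 'k mpoly) = monom_poly l - monom_poly t"
proof -
  show "adjust_sign ord (monom_poly l - monom_poly t :: 'k mpoly) = monom_poly l - monom_poly t"
    by (simp add: adjust_sign_def lead_coef_binomial assms)
  show "adjust_sign ord (monom_poly t - monom_poly l :: 'k mpoly) = monom_poly l - monom_poly t"
  proof (cases "(- 1 :: 'k) = 1")
    case True
    \<comment> \<open>In characteristic 2 the sign is immaterial.\<close>
    have neg: "x = - x" for x :: 'k using True by (metis mult_1 mult_minus_left)
    have "monom_poly t - monom_poly l = (- (monom_poly t - monom_poly l) :: 'k mpoly)"
      by (rule poly_mapping_eqI) (metis lookup_uminus neg)
    then show ?thesis by (simp add: adjust_sign_def)
  qed (simp add: adjust_sign_def lead_coef_binomial assms)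
qed

lemma adjust_sign_image: "adjust_sign ord ` B = binomials"
proof
  show "adjust_sign ord ` B \<subseteq> binomials"
    using B_binomial R_ord adjust_sign_binomial unfolding binomials_def by fastforce
  show "binomials \<subseteq> adjust_sign ord ` B"
  proof
    fix g assume "g \<in> binomials"
    then obtain l t where lt: "(l, t) \<in> R" and g: "g = monom_poly l - monom_poly t"
      unfolding binomials_def by blast
    note adj = adjust_sign_binomial[OF R_ord[OF lt]]
    show "g \<in> adjust_sign ord ` B"
      using R_binomial[OF lt] adj g by (metis image_eqI)
  qed
qed

lemma binomials_subset_ideal: "binomials \<subseteq> ideal_gen V B"
proof
  fix g assume "g \<in> binomials"
  then obtain l t where lt: "(l, t) \<in> R" and g: "g = monom_poly l - monom_poly t"
    unfolding binomials_def by blast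
  have "- (monom_poly t - monom_poly l) = (monom_poly l - monom_poly t :: 'k mpoly)" by simp
  then show "g \<in> ideal_gen V B"
    using R_binomial[OF lt] g ideal_gen_generator ideal_gen_uminus by metis
qed

lemma ideal_subset_poly_ring: "ideal_gen V B \<subseteq> poly_ring V"
proof (rule ideal_gen_subset_poly_ring, rule subsetI)
  fix g assume "g \<in> B"
  then show "g \<in> poly_ring V"
    using B_binomial[of g] R_keys by (auto intro!: poly_ring_diff)
qed

lemma zero_notin_binomials: "0 \<notin> binomials"
proof
  assume "0 \<in> binomials"
  then obtain l t where lt: "(l, t) \<in> R" and "0 = (monom_poly l - monom_poly t :: 'k mpoly)"
    unfolding binomials_def by blast
  then have "Poly_Mapping.lookup (monom_poly l :: 'k mpoly) l = Poly_Mapping.lookup (monom_poly t) l"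
    by simp
  then show False using R_neq[OF lt] by (simp add: lookup_monom_poly)
qed

lemma lead_monoms_binomials:
  "(\<lambda>f. monom_poly (lead_monom ord f)) ` (binomials - {0}) = monom_poly ` fst ` R"
proof -
  have "lead_monom ord (monom_poly l - monom_poly t :: 'k mpoly) = l" if "(l, t) \<in> R" for l t
    using lead_monom_binomial(1)[OF R_ord[OF that], where 'k = 'k] .
  then have "(\<lambda>f. monom_poly (lead_monom ord f)) ` binomials = monom_poly ` fst ` R"
    unfolding binomials_def by force
  moreover have "binomials - {0} = binomials" using zero_notin_binomials by blast
  ultimately show ?thesis by simp
qed

lemma groebner_basis_iff:
  "groebner_basis V ord (ideal_gen V B) binomials \<longleftrightarrow>
    (\<forall>f\<in>ideal_gen V B - {0}. \<exists>(l, t)\<in>R. monom_dvd l (lead_monom ord f))"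
proof
  assume gb: "groebner_basis V ord (ideal_gen V B) binomials"
  show "\<forall>f\<in>ideal_gen V B - {0}. \<exists>(l, t)\<in>R. monom_dvd l (lead_monom ord f)"
  proof
    fix f assume f: "f \<in> ideal_gen V B - {0}"
    then have "monom_poly (lead_monom ord f) \<in> initial_ideal V ord (ideal_gen V B)"
      unfolding initial_ideal_def by (auto intro: ideal_gen_generator)
    then have "(monom_poly (lead_monom ord f) :: 'k mpoly) \<in> ideal_gen V (monom_poly ` fst ` R)"
      using gb unfolding groebner_basis_def initial_ideal_def lead_monoms_binomials by simp
    then obtain l where "l \<in> fst ` R" "monom_dvd l (lead_monom ord f)"
      using keys_monomial_ideal[of "monom_poly (lead_monom ord f) :: 'k mpoly" V "fst ` R"
          "lead_monom ord f"]
      by (auto simp: monom_poly_def)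
    then show "\<exists>(l, t)\<in>R. monom_dvd l (lead_monom ord f)" by auto
  qed
next
  assume dvd: "\<forall>f\<in>ideal_gen V B - {0}. \<exists>(l, t)\<in>R. monom_dvd l (lead_monom ord f)"
  have "initial_ideal V ord (ideal_gen V B) \<subseteq> initial_ideal V ord binomials"
    unfolding initial_ideal_def lead_monoms_binomials
  proof (rule ideal_gen_least, rule subsetI, elim imageE)
    fix g :: "'k mpoly" and f
    assume g: "g = monom_poly (lead_monom ord f)" and f: "f \<in> ideal_gen V B - {0}"
    then obtain l t u where lt: "(l, t) \<in> R" and u: "lead_monom ord f = l + u"
      using dvd unfolding monom_dvd_def by blast
    have "Poly_Mapping.keys (lead_monom ord f) \<subseteq> V"
      using lead_monom_greatest(1)[of f] f ideal_subset_poly_ring by (auto simp: poly_ring_def)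
    moreover have "Poly_Mapping.keys u \<subseteq> Poly_Mapping.keys (l + u)"
      by (auto simp: in_keys_iff lookup_add)
    ultimately have "(monom_poly u :: 'k mpoly) \<in> poly_ring V" using u by auto
    then have "monom_poly u * monom_poly l \<in> ideal_gen V (monom_poly ` fst ` R :: 'k mpoly set)"
      using lt by (intro ideal_gen_mult ideal_gen_generator) force+
    then show "g \<in> ideal_gen V (monom_poly ` fst ` R)"
      using g u by (simp add: monom_poly_mult add.commute)
  qed
  moreover have "initial_ideal V ord binomials \<subseteq> initial_ideal V ord (ideal_gen V B)"
    unfolding initial_ideal_def using binomials_subset_ideal
    by (intro ideal_gen_least subsetI ideal_gen_generator) auto
  moreover have "binomials = (\<lambda>(l, t). monom_poly l - monom_poly t) ` R"
    unfolding binomials_def by auto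
  then have "finite binomials" using finite_R by simp
  ultimately show "groebner_basis V ord (ideal_gen V B) binomials"
    unfolding groebner_basis_def using zero_notin_binomials binomials_subset_ideal by blast
qed

lemma step_diff_in_ideal:
  assumes "step R m n" "Poly_Mapping.keys m \<subseteq> V"
  shows "monom_poly m - monom_poly n \<in> ideal_gen V B"
proof -
  obtain l t w where lt: "(l, t) \<in> R" and m: "m = l + w" and n: "n = t + w"
    using assms(1) unfolding step_def by blast
  have "Poly_Mapping.keys w \<subseteq> V"
    using assms(2) unfolding m by (auto simp: in_keys_iff lookup_add)
  moreover have "monom_poly l - monom_poly t \<in> ideal_gen V B"
    using lt binomials_subset_ideal unfolding binomials_def by blast
  ultimately have "monom_poly w * (monom_poly l - monom_poly t) \<in> ideal_gen V B"
    by (intro ideal_gen_mult) simp_all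
  then show ?thesis
    by (simp add: m n right_diff_distrib monom_poly_mult add.commute)
qed

lemma step_ord: "step R m n \<Longrightarrow> ord n m"
  unfolding step_def using R_ord ord_add by blast

lemma steps_ord: "(step R)\<^sup>*\<^sup>* m n \<Longrightarrow> m = n \<or> ord n m"
  by (induction rule: rtranclp_induct) (use step_ord ord_trans in blast)+

lemma wfP_step: "wfP (\<lambda>n m. step R m n)"
proof -
  \<comment> \<open>The set of monomials below \<open>m\<close> in the variables of \<open>V\<close> and of \<open>m\<close> is finite and shrinks
    in every step.\<close>
  define below where "below m = {n. Poly_Mapping.keys n \<subseteq> V \<union> Poly_Mapping.keys m
    \<and> mdegree n \<le> mdegree m \<and> ord n m}" for m
  have fin: "finite (below m)" for m
  proof (rule finite_subset)
    show "below m \<subseteq> (\<Union>d\<le>mdegree m. {n. Poly_Mapping.keys n \<subseteq> V \<union> Poly_Mapping.keys m \<and> mdegree n = d})"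
      unfolding below_def by auto
    show "finite (\<Union>d\<le>mdegree m. {n. Poly_Mapping.keys n \<subseteq> V \<union> Poly_Mapping.keys m \<and> mdegree n = d})"
      using finite_V by (intro finite_UN_I finite_monoms_of_degree) auto
  qed
  have "below n \<subset> below m" if mn: "step R m n" for m n
  proof -
    obtain l t w where lt: "(l, t) \<in> R" and m: "m = l + w" and n: "n = t + w"
      using mn unfolding step_def by blast
    have "Poly_Mapping.keys w \<subseteq> Poly_Mapping.keys m"
      unfolding m by (auto simp: in_keys_iff lookup_add)
    then have keys: "Poly_Mapping.keys n \<subseteq> V \<union> Poly_Mapping.keys m"
      using keys_add[of t w] R_keys[OF lt] unfolding n by blast
    have ord: "ord n m" using mn by (rule step_ord)
    then have deg: "mdegree n \<le> mdegree m" by (auto simp: grevlex_def)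
    have "below n \<subseteq> below m"
    proof
      fix p assume "p \<in> below n"
      then show "p \<in> below m"
        using keys deg ord ord_trans[of p n m] unfolding below_def by auto
    qed
    moreover have "n \<in> below m" using keys ord deg by (simp add: below_def)
    moreover have "n \<notin> below n" using ord_irrefl by (simp add: below_def)
    ultimately show ?thesis by blast
  qed
  then have "card (below n) < card (below m)" if "step R m n" for m n
    using that fin psubset_card_mono by metis
  then show ?thesis by (intro wfp_if_convertible_to_nat)
qed

text \<open>Buchberger's criterion in this setting. For a monomial \<open>m\<close> admitting no step, the functional
  \<^const>\<open>coeff_sum\<close> for the set of monomials rewriting to \<open>m\<close> vanishes on the ideal by confluence.
  It does not vanish on a polynomial with leading monomial \<open>m\<close>, as everything else rewriting to
  \<open>m\<close> is larger than \<open>m\<close>.\<close>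

lemma groebner_basis_if_locally_confluent:
  assumes "\<And>m p q. step R m p \<Longrightarrow> step R m q \<Longrightarrow> joinable R p q"
  shows "groebner_basis V ord (ideal_gen V B) binomials"
  unfolding groebner_basis_iff
proof (rule ballI, rule ccontr)
  fix f assume f: "f \<in> ideal_gen V B - {0}"
    and nodvd: "\<not> (\<exists>(l, t)\<in>R. monom_dvd l (lead_monom ord f))"
  define m where "m = lead_monom ord f"
  define S where "S = {n. (step R)\<^sup>*\<^sup>* n m}"
  have irr: "\<not> step R m n" for n
    using nodvd unfolding step_def monom_dvd_def m_def by blast
  have confl: "p \<in> S \<longleftrightarrow> q \<in> S" if pq: "step R p q" for p q
  proof
    assume "p \<in> S"
    then have "(step R)\<^sup>*\<^sup>* p m" by (simp add: S_def)
    then obtain z where z: "(step R)\<^sup>*\<^sup>* m z" "(step R)\<^sup>*\<^sup>* q z"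
      using newman[OF wfP_step, of p m q] assms pq unfolding joinable_def by blast
    have "z = m" using z(1) irr by (metis converse_rtranclpE)
    then show "q \<in> S" using z(2) by (simp add: S_def)
  qed (use pq in \<open>auto simp: S_def intro: converse_rtranclp_into_rtranclp\<close>)
  have confl': "u + l \<in> S \<longleftrightarrow> u + t \<in> S" if "(l, t) \<in> R" for u l t
  proof (rule confl)
    show "step R (u + l) (u + t)" unfolding step_def using that by (metis add.commute)
  qed
  have "coeff_sum S f = 0"
  proof (rule coeff_sum_ideal_eq_zero)
    show "f \<in> ideal_gen V B" using f by blast
    show "\<exists>l t. g = monom_poly l - monom_poly t \<and> (\<forall>u. u + l \<in> S \<longleftrightarrow> u + t \<in> S)" if "g \<in> B" for g
      using B_binomial[OF that] confl' by blast
  qed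
  moreover have "coeff_sum S f = Poly_Mapping.lookup f m"
  proof -
    have fV: "f \<in> poly_ring V" "f \<noteq> 0" using f ideal_subset_poly_ring by auto
    have "n \<notin> S" if "n \<in> Poly_Mapping.keys f" "n \<noteq> m" for n
      using that lead_monom_greatest(2)[OF fV that(1)] steps_ord[of n m] ord_trans[of n m n]
        ord_irrefl unfolding S_def m_def by blast
    moreover have "m \<in> S" by (simp add: S_def)
    moreover have "m \<in> Poly_Mapping.keys f"
      using lead_monom_greatest(1)[OF fV] by (simp add: m_def)
    ultimately have "coeff_sum S f = (\<Sum>n\<in>Poly_Mapping.keys f. if n = m then Poly_Mapping.lookup f n else 0)"
      unfolding coeff_sum_def by (intro sum.cong) auto
    then show ?thesis using \<open>m \<in> Poly_Mapping.keys f\<close> by simp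
  qed
  moreover have "m \<in> Poly_Mapping.keys f"
    using lead_monom_greatest(1)[of f] f ideal_subset_poly_ring by (auto simp: m_def)
  ultimately show False by (simp add: in_keys_iff)
qed

lemma reduced_if_groebner_basis:
  assumes gb: "groebner_basis V ord (ideal_gen V B) binomials"
    and deg: "\<And>l t. (l, t) \<in> R \<Longrightarrow> mdegree l = d \<and> mdegree t = d"
    and inj: "\<And>l t t'. (l, t) \<in> R \<Longrightarrow> (l, t') \<in> R \<Longrightarrow> t = t'"
    and irr: "\<And>l t l'. (l, t) \<in> R \<Longrightarrow> (l', l) \<notin> R"
  shows "reduced_groebner_basis_up_to_sign V ord (ideal_gen V B) B"
  unfolding reduced_groebner_basis_up_to_sign_def reduced_groebner_basis_def adjust_sign_image
proof (intro conjI ballI impI)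
  show "lead_coef ord g = 1" if "g \<in> binomials" for g
    using that R_ord lead_coef_binomial(1) unfolding binomials_def by blast
  fix g h m
  assume "g \<in> binomials" "h \<in> binomials" and neq: "h \<noteq> g" and m: "m \<in> Poly_Mapping.keys g"
  then obtain l t l' t' where g: "g = monom_poly l - monom_poly t" "(l, t) \<in> R"
    and h: "h = monom_poly l' - monom_poly t'" "(l', t') \<in> R"
    unfolding binomials_def by blast
  have lead: "lead_monom ord h = l'"
    using lead_monom_binomial(1)[OF R_ord[OF h(2)], where 'k = 'k] h(1) by simp
  have m_cases: "m = l \<or> m = t"
    using m unfolding g(1) by (auto simp: in_keys_iff lookup_minus lookup_monom_poly split: if_splits)
  show "\<not> monom_dvd (lead_monom ord h) m"
  proof
    assume "monom_dvd (lead_monom ord h) m"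
    then obtain u where u: "m = l' + u" unfolding lead monom_dvd_def by blast
    have "mdegree m = mdegree l'" using m_cases deg g(2) h(2) by metis
    then have "u = 0" using u by (simp add: mdegree_add mdegree_eq_0_iff)
    then have "m = l'" using u by simp
    then show False using m_cases inj irr g h neq by metis
  qed
qed (rule gb)

end

section \<open>Sorting rules on a grid\<close>

lemma single_add_eqE:
  fixes w u :: monom
  assumes "Poly_Mapping.single p 1 + w = Poly_Mapping.single q 1 + u" "p \<noteq> q"
  obtains s where "w = Poly_Mapping.single q 1 + s" "u = Poly_Mapping.single p 1 + s"
proof -
  define s where "s = w - Poly_Mapping.single q 1"
  have "Poly_Mapping.lookup (Poly_Mapping.single p 1 + w) q
    = Poly_Mapping.lookup (Poly_Mapping.single q 1 + u) q" using assms(1) by simp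
  then have "Poly_Mapping.lookup w q \<ge> 1"
    using assms(2) by (simp add: lookup_add lookup_single)
  then have w: "w = Poly_Mapping.single q 1 + s"
    unfolding s_def
    by (intro poly_mapping_eqI) (auto simp: lookup_add lookup_minus lookup_single when_def)
  have "Poly_Mapping.single q 1 + u = Poly_Mapping.single q 1 + (Poly_Mapping.single p 1 + s)"
    using assms(1) unfolding w by (simp add: add.left_commute)
  then have "u = Poly_Mapping.single p 1 + s" by (simp only: add_left_cancel)
  with w show thesis by (rule that)
qed

text \<open>Columns and rows carry the increasing or the decreasing order, \<open>vx c r\<close> is the vertex
  in column \<open>c\<close> and row \<open>r\<close>, and \<open>inn x x' y y'\<close> says that the columns \<open>x, x'\<close> and the rows
  \<open>y, y'\<close> bound an inner interval.\<close>

locale grid =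
  fixes lc lr :: "nat \<Rightarrow> nat \<Rightarrow> bool"
    and inn :: "nat \<Rightarrow> nat \<Rightarrow> nat \<Rightarrow> nat \<Rightarrow> bool"
    and vx :: "nat \<Rightarrow> nat \<Rightarrow> vertex"
  assumes lc_cases: "lc = (<) \<or> lc = (>)"
    and lr_cases: "lr = (<) \<or> lr = (>)"
    and vx_inj: "vx c r = vx c' r' \<longleftrightarrow> c = c' \<and> r = r'"
    and inn_col_sym: "inn x x' y y' \<Longrightarrow> inn x' x y y'"
    and inn_row_sym: "inn x x' y y' \<Longrightarrow> inn x x' y' y"
    and inn_neq: "inn x x' y y' \<Longrightarrow> x \<noteq> x' \<and> y \<noteq> y'"
    and inn_col_split:
      "lc x0 x1 \<Longrightarrow> lc x1 x2 \<Longrightarrow> inn x0 x2 y y' \<longleftrightarrow> inn x0 x1 y y' \<and> inn x1 x2 y y'"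
    and inn_row_split:
      "lr y0 y1 \<Longrightarrow> lr y1 y2 \<Longrightarrow> inn x x' y0 y2 \<longleftrightarrow> inn x x' y0 y1 \<and> inn x x' y1 y2"
begin

lemma lc_trans: "lc a b \<Longrightarrow> lc b c \<Longrightarrow> lc a c"
  and lc_irrefl: "\<not> lc a a"
  and lc_total: "lc a b \<or> a = b \<or> lc b a"
  using lc_cases by auto

lemma lr_trans: "lr a b \<Longrightarrow> lr b c \<Longrightarrow> lr a c"
  and lr_irrefl: "\<not> lr a a"
  and lr_total: "lr a b \<or> a = b \<or> lr b a"
  using lr_cases by auto

lemma inn_col_trans:
  assumes "inn a b y y'" "inn b c y y'" "a \<noteq> c" shows "inn a c y y'"
proof -
  have "lc a b \<or> lc b a" "lc b c \<or> lc c b" "lc a c \<or> lc c a"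
    using inn_neq[OF assms(1)] inn_neq[OF assms(2)] assms(3) lc_total by blast+
  then show ?thesis
    using assms(1,2) inn_col_split[of a b c y y'] inn_col_split[of a c b y y']
      inn_col_split[of b a c y y'] inn_col_split[of b c a y y'] inn_col_split[of c a b y y']
      inn_col_split[of c b a y y'] inn_col_sym[of _ _ y y'] by metis
qed

lemma inn_row_lower: "inn x x' y0 y2 \<Longrightarrow> lr y0 y1 \<Longrightarrow> lr y1 y2 \<Longrightarrow> inn x x' y0 y1"
  and inn_row_upper: "inn x x' y0 y2 \<Longrightarrow> lr y0 y1 \<Longrightarrow> lr y1 y2 \<Longrightarrow> inn x x' y1 y2"
  using inn_row_split by blast+

text \<open>The variable at the vertex in column \<open>c\<close> and row \<open>r\<close>, as a monomial.\<close>

definition X :: "nat \<Rightarrow> nat \<Rightarrow> monom" where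
  "X c r = Poly_Mapping.single (vx c r) 1"

text \<open>Given an order \<open>lt y\<close> of the columns for every row \<open>y\<close>, each inner interval yields one rule.
  With \<open>y\<close> the lower of its rows and \<open>x\<close> the first of its columns for \<open>lt y\<close>, it replaces the
  corners \<open>(x, y')\<close> and \<open>(x', y)\<close> by the other two.\<close>

definition rules :: "(nat \<Rightarrow> nat \<Rightarrow> nat \<Rightarrow> bool) \<Rightarrow> (monom \<times> monom) set" where
  "rules lt = {(X x y' + X x' y, X x y + X x' y') | x x' y y'. lr y y' \<and> lt y x x' \<and> inn x x' y y'}"

lemma X_add_eqE:
  assumes "X a b + w = X c d + u" "(a, b) \<noteq> (c, d)"
  obtains s where "w = X c d + s" "u = X a b + s"
  using single_add_eqE[of "vx a b" w "vx c d" u] assms vx_inj unfolding X_def by auto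

lemma X_eq_iff: "X a b = X c d \<longleftrightarrow> a = c \<and> b = d"
  unfolding X_def
  by (metis keys_single singleton_inject vx_inj zero_neq_one)

lemma X_pair_eq:
  assumes "X a b + X a' b' = X c d + X c' d'"
  shows "(a, b) = (c, d) \<and> (a', b') = (c', d') \<or> (a, b) = (c', d') \<and> (a', b') = (c, d)"
proof (cases "(a, b) = (c, d)")
  case True
  then show ?thesis using assms by (simp add: X_eq_iff)
next
  case False
  obtain s where s: "X a' b' = X c d + s" "X c' d' = X a b + s"
    using assms False by (rule X_add_eqE)
  have "mdegree (X a' b') = mdegree (X c d + s)" using s(1) by simp
  then have "s = 0" by (simp add: X_def mdegree_add mdegree_eq_0_iff)
  then show ?thesis using s by (simp add: X_eq_iff)
qed

lemma mdegree_rules: "(l, t) \<in> rules lt \<Longrightarrow> mdegree l = 2 \<and> mdegree t = 2"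
  by (auto simp: rules_def X_def mdegree_add)

lemma rules_det:
  assumes "(l, t) \<in> rules lt" "(l, t') \<in> rules lt" shows "t = t'"
proof -
  obtain x x' y y' where 1: "l = X x y' + X x' y" "t = X x y + X x' y'" "lr y y'"
    using assms(1) unfolding rules_def by blast
  obtain a a' b b' where 2: "l = X a b' + X a' b" "t' = X a b + X a' b'" "lr b b'"
    using assms(2) unfolding rules_def by blast
  have "X x y' + X x' y = X a b' + X a' b" using 1(1) 2(1) by simp
  from X_pair_eq[OF this] show ?thesis using 1 2 lr_trans lr_irrefl by blast
qed

lemma rules_irreversible:
  assumes asym: "\<And>y a b. lt y a b \<Longrightarrow> \<not> lt y b a"
    and "(l, t) \<in> rules lt" shows "(l', l) \<notin> rules lt"
proof
  assume "(l', l) \<in> rules lt"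
  then obtain a a' b b' where 2: "l = X a b + X a' b'" "lr b b'" "lt b a a'"
    unfolding rules_def by blast
  obtain x x' y y' where 1: "l = X x y' + X x' y" "lr y y'" "lt y x x'"
    using assms(2) unfolding rules_def by blast
  have "X x y' + X x' y = X a b + X a' b'" using 1(1) 2(1) by simp
  from X_pair_eq[OF this] show False using 1 2 lr_trans lr_irrefl asym by blast
qed

end


section \<open>Local confluence for the rotated orders\<close>

text \<open>The vertices preceding \<open>vx v1 v2\<close> in the lexicographic order (columns first) are moved
  above all others. Within a row this rotates the columns: the cut lies right of the column \<open>v1\<close>
  in the rows below \<open>v2\<close>, and left of it in all other rows. The assumption \<open>corner\<close> expresses
  local confluence for the order before the rotation, \<open>no_pi_I\<close> and \<open>no_pi_II\<close> say that \<open>vx v1 v2\<close>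
  does not satisfy the condition attached to the order.\<close>

locale rotated_grid = grid +
  fixes v1 v2 :: nat
  assumes corner: "lc x0 x1 \<Longrightarrow> lc x1 x2 \<Longrightarrow> lr y0 y1 \<Longrightarrow> lr y1 y2 \<Longrightarrow>
      inn x0 x1 y1 y2 \<Longrightarrow> inn x1 x2 y0 y1 \<Longrightarrow> inn x0 x1 y0 y1 \<or> inn x1 x2 y1 y2"
    and no_pi_I: "lc v1 x1 \<Longrightarrow> lc x1 x2 \<Longrightarrow> lr y0 v2 \<Longrightarrow> lr v2 y2 \<Longrightarrow>
      inn v1 x1 y0 v2 \<Longrightarrow> inn x1 x2 y0 v2 \<Longrightarrow> inn v1 x1 v2 y2 \<Longrightarrow> inn x1 x2 v2 y2"
    and no_pi_II: "lc x0 v1 \<Longrightarrow> lc v1 x2 \<Longrightarrow> lr y0 v2 \<Longrightarrow> lr v2 y2 \<Longrightarrow>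
      inn x0 v1 y0 v2 \<Longrightarrow> inn v1 x2 y0 v2 \<Longrightarrow> inn v1 x2 v2 y2 \<Longrightarrow> inn x0 v1 v2 y2"
begin

text \<open>\<open>low y x\<close> says that the vertex in column \<open>x\<close> and row \<open>y\<close> precedes \<open>vx v1 v2\<close>, and
  \<open>lt y\<close> is the rotated order restricted to the row \<open>y\<close>.\<close>

definition low :: "nat \<Rightarrow> nat \<Rightarrow> bool" where
  "low y x \<longleftrightarrow> lc x v1 \<or> x = v1 \<and> lr y v2"

definition lt :: "nat \<Rightarrow> nat \<Rightarrow> nat \<Rightarrow> bool" where
  "lt y a b \<longleftrightarrow> (if low y a = low y b then lc a b else low y b)"

lemma lt_irrefl: "\<not> lt y a a"
  and lt_trans: "lt y a b \<Longrightarrow> lt y b c \<Longrightarrow> lt y a c"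
  and lt_total: "lt y a b \<or> a = b \<or> lt y b a"
  using lc_cases lr_cases by (auto simp: lt_def low_def split: if_splits)

lemma lt_asym: "lt y a b \<Longrightarrow> \<not> lt y b a"
  using lt_trans lt_irrefl by blast

text \<open>The column \<open>v1\<close>, the last one in the rows below \<open>v2\<close> and the first one in the others, is
  the only column whose position depends on the row.\<close>

lemma lt_change:
  assumes "lt y a b" "lt y' b a" "lr y y'"
  shows "b = v1 \<and> lr y v2 \<and> \<not> lr y' v2"
  using assms lc_cases lr_cases by (auto simp: lt_def low_def split: if_splits)

text \<open>Both conditions on \<open>vx v1 v2\<close> in one statement: for columns \<open>a\<close> before \<open>b\<close> in the rotated
  order, an inner interval between \<open>v1\<close> and \<open>b\<close> below the row \<open>v2\<close> extends above this row as
  far as one between \<open>v1\<close> and \<open>a\<close> does. If \<open>b\<close> lies between \<open>a\<close> and \<open>v1\<close>, no condition is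
  needed.\<close>

lemma no_pi:
  assumes "lt y0 a b" "a \<noteq> v1" "b \<noteq> v1" "lr y0 v2" "lr v2 y2"
    and a: "inn v1 a y0 y2" and b: "inn v1 b y0 v2"
  shows "inn v1 b y0 y2"
proof -
  have a': "inn v1 a y0 v2" "inn v1 a v2 y2" using inn_row_split assms by blast+
  have neq: "a \<noteq> b" using lt_irrefl assms(1) by blast
  have ab: "inn a b y0 v2" using inn_col_trans[OF inn_col_sym[OF a'(1)] b neq] .
  consider "lc a b" "lc b v1" | "lc v1 a" "lc a b" | "lc b v1" "lc v1 a"
    using assms(1-3) lc_total[of a v1] lc_total[of b v1] lc_cases
    by (auto simp: lt_def low_def split: if_splits)
  then show ?thesis
  proof cases
    case 1
    then show ?thesis using inn_col_split[of a b v1] a inn_col_sym by blast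
  next
    case 2
    then have "inn a b v2 y2" using no_pi_I assms(4,5) a' ab by blast
    then have "inn v1 b v2 y2" using inn_col_split 2 a' by blast
    then show ?thesis using inn_row_split assms(4,5) b by blast
  next
    case 3
    then have "inn b v1 v2 y2" using no_pi_II assms(4,5) a' b inn_col_sym by blast
    then show ?thesis using inn_row_split assms(4,5) b inn_col_sym by blast
  qed
qed

text \<open>The first two assumptions imply that \<open>x0, x1, x2\<close> are in cyclic order. If they are not
  increasing, then one of the intervals in the conclusion is contained in one of those in the
  assumptions.\<close>

lemma rotated_corner:
  assumes "lt y1 x0 x1" "lt y0 x1 x2" "lr y0 y1" "lr y1 y2" "x0 \<noteq> x2"
    and "inn x0 x1 y1 y2" "inn x1 x2 y0 y1"
  shows "inn x0 x1 y0 y1 \<or> inn x1 x2 y1 y2"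
proof -
  consider "lc x0 x1" "lc x1 x2" | "lc x1 x2" "lc x2 x0" | "lc x2 x0" "lc x0 x1"
    using assms(1-5) lc_cases lr_cases by (auto simp: lt_def low_def split: if_splits)
  then show ?thesis
  proof cases
    case 1
    then show ?thesis using corner assms by blast
  next
    case 2
    then show ?thesis using inn_col_split[of x1 x2 x0] assms inn_col_sym by blast
  next
    case 3
    then show ?thesis using inn_col_split[of x2 x0 x1] assms inn_col_sym by blast
  qed
qed

abbreviation R :: "(monom \<times> monom) set" where
  "R \<equiv> rules lt"

lemma stepI:
  assumes "lr y y'" "lt y x x'" "inn x x' y y'"
    and "m = X x y' + X x' y + w" "n = X x y + X x' y' + w"
  shows "step R m n"
  using assms unfolding step_def rules_def by blast

text \<open>The exchange of the two diagonals of an inner interval is a step in one of the two directions.\<close>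

lemma exchange_joinable:
  assumes "lr y y'" "inn x x' y y'"
    and "m = X x y' + X x' y + w" "n = X x y + X x' y' + w"
  shows "joinable R m n"
proof -
  have "lt y x x' \<or> lt y x' x" using lt_total inn_neq assms(2) by blast
  then show ?thesis
  proof
    assume "lt y x x'"
    then have "step R m n" using stepI assms by blast
    then show ?thesis by (rule joinable_step_left) simp
  next
    assume "lt y x' x"
    then have "step R n m"
      using stepI[OF assms(1) _ inn_col_sym[OF assms(2)], of n w m] assms(3,4) by (simp add: ac_simps)
    then show ?thesis by (rule joinable_step_right) simp
  qed
qed

text \<open>The two rules apply to a product of three variables and share the lower vertex, which
  is in column \<open>x\<close> and row \<open>y\<close>.\<close>

lemma overlap_lower:
  assumes 1: "lr y y1" "lt y x1 x" "inn x1 x y y1"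
    and 2: "lr y y2" "lt y x2 x" "inn x2 x y y2"
  shows "joinable R (X x1 y + X x y1 + X x2 y2) (X x2 y + X x y2 + X x1 y1)"
proof -
  have same: ?thesis if "y1 = y2" "x1 \<noteq> x2"
  proof (rule exchange_joinable)
    show "inn x2 x1 y y1" using inn_col_trans 1(3) 2(3) inn_col_sym that by blast
  qed (use 1(1) that in \<open>simp_all add: ac_simps\<close>)
  have different: "joinable R (X x1 y + X x y1 + X x2 y2) (X x2 y + X x y2 + X x1 y1)"
    if 1: "lr y y1" "lt y x1 x" "inn x1 x y y1"
      and 2: "lr y y2" "lt y x2 x" "inn x2 x y y2" and less: "lr y1 y2"
    for x1 x2 y1 y2
  proof -
    have upper: "inn x2 x y1 y2" and lower: "inn x2 x y y1"
      using inn_row_split[OF 1(1) less] 2(3) by blast+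
    have cols: "inn x1 x2 y y1" if "x1 \<noteq> x2"
      using inn_col_trans[OF 1(3) inn_col_sym[OF lower] that] .
    consider "x1 = x2" | "lt y x1 x2" | "lt y x2 x1" "lt y1 x2 x" | "lt y x2 x1" "lt y1 x x2"
      using lt_total[of y x1 x2] lt_total[of y1 x2 x] inn_neq[OF 2(3)] by blast
    then show ?thesis
    proof cases
      case 1
      show ?thesis
        by (rule exchange_joinable[OF less upper, of _ "X x1 y"]) (simp_all add: 1 ac_simps)
    next
      case 2
      then have "inn x1 x2 y y1" using cols lt_irrefl by blast
      then have "step R (X x2 y + X x y2 + X x1 y1) (X x1 y + X x2 y1 + X x y2)"
        using 1(1) 2 by (intro stepI[of y y1 x1 x2 _ "X x y2"]) (simp_all add: ac_simps)
      moreover have "joinable R (X x1 y + X x y1 + X x2 y2) (X x1 y + X x2 y1 + X x y2)"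
        by (rule exchange_joinable[OF less upper, of _ "X x1 y"]) (simp_all add: ac_simps)
      ultimately show ?thesis by (rule joinable_step_right)
    next
      case 3
      then have "inn x2 x1 y y1" using cols inn_col_sym lt_irrefl by blast
      then have "joinable R (X x1 y + X x2 y1 + X x y2) (X x2 y + X x y2 + X x1 y1)"
        using 1(1) by (intro exchange_joinable[of y y1 x2 x1 _ "X x y2"]) (simp_all add: ac_simps)
      moreover have "step R (X x1 y + X x y1 + X x2 y2) (X x1 y + X x2 y1 + X x y2)"
        by (rule stepI[OF less 3(2) upper, of _ "X x1 y"]) (simp_all add: ac_simps)
      ultimately show ?thesis by (rule joinable_step_left[rotated])
    next
      case 4
      \<comment> \<open>The position of \<open>x\<close> changes between the rows \<open>y\<close> and \<open>y1\<close>, so \<open>x = v1\<close>.\<close>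
      have x: "x = v1" and y: "lr y v2" "\<not> lr y1 v2" using lt_change[OF 2(2) 4(2) 1(1)] by auto
      have v2: "lr v2 y2" using y(2) less lr_total lr_trans by blast
      have low: "inn v1 x1 y v2"
        using x y 1(3) inn_col_sym inn_row_lower lr_total by metis
      have neq: "x1 \<noteq> x2" using lt_irrefl 4(1) by blast
      have "inn v1 x1 y y2"
        using no_pi[OF 4(1) _ _ y(1) v2 _ low] x 2(3) 1(3) inn_neq inn_col_sym by blast
      then have x1: "inn x1 x y y2" using x inn_col_sym by blast
      have "inn x2 x1 y y2" using inn_col_trans[OF 2(3) inn_col_sym[OF x1]] neq by blast
      then have "step R (X x1 y + X x y1 + X x2 y2) (X x2 y + X x1 y2 + X x y1)"
        using 2(1) 4(1) by (intro stepI[of y y2 x2 x1 _ "X x y1"]) (simp_all add: ac_simps)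
      moreover have "joinable R (X x2 y + X x1 y2 + X x y1) (X x2 y + X x y2 + X x1 y1)"
        by (rule joinable_sym,
            rule exchange_joinable[OF less inn_col_sym[OF inn_row_upper[OF x1 1(1) less]], of _ "X x2 y"])
          (simp_all add: ac_simps)
      ultimately show ?thesis by (rule joinable_step_left)
    qed
  qed
  show ?thesis
  proof (cases "y1 = y2")
    case True
    then show ?thesis using same by (cases "x1 = x2") simp_all
  next
    case False
    then show ?thesis
      using lr_total different[OF 1 2] joinable_sym[OF different[OF 2 1]] by blast
  qed
qed

text \<open>The two rules share the upper vertex, which is in column \<open>x\<close> and row \<open>y\<close>.\<close>

lemma overlap_upper:
  assumes 1: "lr y1 y" "lt y1 x x1" "inn x x1 y1 y"
    and 2: "lr y2 y" "lt y2 x x2" "inn x x2 y2 y"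
  shows "joinable R (X x y1 + X x1 y + X x2 y2) (X x y2 + X x2 y + X x1 y1)"
proof -
  have same: ?thesis if "y1 = y2" "x1 \<noteq> x2"
  proof (rule exchange_joinable)
    show "inn x1 x2 y1 y" using inn_col_trans 1(3) 2(3) inn_col_sym that by blast
  qed (use 1(1) that in \<open>simp_all add: ac_simps\<close>)
  have different: "joinable R (X x y1 + X x1 y + X x2 y2) (X x y2 + X x2 y + X x1 y1)"
    if 1: "lr y1 y" "lt y1 x x1" "inn x x1 y1 y"
      and 2: "lr y2 y" "lt y2 x x2" "inn x x2 y2 y" and less: "lr y1 y2"
    for x1 x2 y1 y2
  proof -
    have lower: "inn x x1 y1 y2" and upper: "inn x x1 y2 y"
      using inn_row_split[OF less 2(1)] 1(3) by blast+
    have "step R (X x y2 + X x2 y + X x1 y1) (X x y1 + X x1 y2 + X x2 y)"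
      by (rule stepI[OF less 1(2) lower, of _ "X x2 y"]) (simp_all add: ac_simps)
    moreover have "joinable R (X x y1 + X x1 y + X x2 y2) (X x y1 + X x1 y2 + X x2 y)"
    proof (cases "x1 = x2")
      case False
      have "inn x1 x2 y2 y" using inn_col_trans[OF inn_col_sym[OF upper] 2(3) False] .
      then show ?thesis
        using 2(1) by (intro exchange_joinable[of y2 y x1 x2 _ "X x y1"]) (simp_all add: ac_simps)
    qed (simp add: ac_simps)
    ultimately show ?thesis by (rule joinable_step_right)
  qed
  show ?thesis
  proof (cases "y1 = y2")
    case True
    then show ?thesis using same by (cases "x1 = x2") simp_all
  next
    case False
    then show ?thesis
      using lr_total different[OF 1 2] joinable_sym[OF different[OF 2 1]] by blast
  qed
qed

text \<open>The shared vertex, in column \<open>x1\<close> and row \<open>y1\<close>, is the lower one for the first rule and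
  the upper one for the second. The columns \<open>x0\<close> and \<open>x2\<close> may coincide, since the row orders at
  \<open>y0\<close> and \<open>y1\<close> may differ.\<close>

lemma overlap_chain:
  assumes y: "lr y0 y1" "lr y1 y2" and x: "lt y1 x0 x1" "lt y0 x1 x2"
    and UL: "inn x0 x1 y1 y2" and LR: "inn x1 x2 y0 y1"
  shows "joinable R (X x0 y1 + X x1 y2 + X x2 y0) (X x1 y0 + X x2 y1 + X x0 y2)"
proof (cases "x0 = x2")
  case True
  have "inn x1 x0 y0 y2" using inn_row_split y UL LR True inn_col_sym by blast
  moreover have "lr y0 y2" using y lr_trans by blast
  ultimately show ?thesis
    using x True by (intro exchange_joinable[of y0 y2 x1 x0 _ "X x0 y1"]) (simp_all add: ac_simps)
next
  case False
  have y02: "lr y0 y2" using y lr_trans by blast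
  have ?thesis if UR: "inn x1 x2 y1 y2"
  proof -
    have "inn x1 x2 y0 y2" using inn_row_split y LR UR by blast
    then have "step R (X x0 y1 + X x1 y2 + X x2 y0) (X x1 y0 + X x2 y2 + X x0 y1)"
      using y02 x(2) by (intro stepI[of y0 y2 x1 x2 _ "X x0 y1"]) (simp_all add: ac_simps)
    moreover have "inn x0 x2 y1 y2" using inn_col_trans[OF UL UR False] .
    then have "joinable R (X x1 y0 + X x2 y1 + X x0 y2) (X x1 y0 + X x2 y2 + X x0 y1)"
      using y(2) by (intro exchange_joinable[of y1 y2 x0 x2 _ "X x1 y0"]) (simp_all add: ac_simps)
    ultimately show ?thesis using joinable_step_left joinable_sym by blast
  qed
  moreover have ?thesis if LL: "inn x0 x1 y0 y1" and x01: "lt y0 x0 x1"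
  proof -
    have "inn x0 x2 y0 y1" using inn_col_trans[OF LL LR False] .
    then have "step R (X x0 y1 + X x1 y2 + X x2 y0) (X x0 y0 + X x2 y1 + X x1 y2)"
      using y(1) lt_trans[OF x01 x(2)]
      by (intro stepI[of y0 y1 x0 x2 _ "X x1 y2"]) (simp_all add: ac_simps)
    moreover have "inn x0 x1 y0 y2" using inn_row_split y LL UL by blast
    then have "step R (X x1 y0 + X x2 y1 + X x0 y2) (X x0 y0 + X x2 y1 + X x1 y2)"
      using y02 x01 by (intro stepI[of y0 y2 x0 x1 _ "X x2 y1"]) (simp_all add: ac_simps)
    ultimately show ?thesis using joinable_step_left joinable_step_right joinable_refl by blast
  qed
  moreover have "inn x1 x2 y1 y2" if LL: "inn x0 x1 y0 y1" and "\<not> lt y0 x0 x1"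
  proof -
    \<comment> \<open>The position of \<open>x0\<close> changes between the rows \<open>y0\<close> and \<open>y1\<close>, so \<open>x0 = v1\<close>.\<close>
    have "lt y0 x1 x0" using that(2) lt_total inn_neq[OF LL] by blast
    then have v: "x0 = v1" "lr y0 v2" "\<not> lr y1 v2" using lt_change[OF _ x(1) y(1)] by auto
    have v2: "lr v2 y2" using v(3) y(2) lr_total lr_trans by blast
    have all: "inn v1 x1 y0 y2" using inn_row_split y LL UL v(1) by blast
    have low: "inn v1 x2 y0 y1" using inn_col_trans[OF LL LR False] v(1) by simp
    then have low': "inn v1 x2 y0 v2" using v(2,3) inn_row_lower lr_total by metis
    have "inn v1 x2 y0 y2"
      using no_pi[OF x(2) _ _ v(2) v2 all low'] inn_neq[OF low] inn_neq[OF LL] v(1) by auto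
    then have "inn v1 x2 y1 y2" using inn_row_upper y by blast
    then show ?thesis
      using inn_col_trans[of x1 v1 y1 y2 x2] inn_col_sym[OF UL] v(1) inn_neq[OF LR] by blast
  qed
  ultimately show ?thesis using rotated_corner[OF x y False UL LR] by blast
qed

lemma locally_confluent:
  assumes "step R m n" "step R m n'"
  shows "joinable R n n'"
proof -
  obtain a a' c c' w where A: "lr c c'" "lt c a a'" "inn a a' c c'"
    and m: "m = X a c' + X a' c + w" and n: "n = X a c + X a' c' + w"
    using assms(1) unfolding step_def rules_def by blast
  obtain b b' d d' u where B: "lr d d'" "lt d b b'" "inn b b' d d'"
    and m': "m = X b d' + X b' d + u" and n': "n' = X b d + X b' d' + u"
    using assms(2) unfolding step_def rules_def by blast
  have eq: "X a c' + (X a' c + w) = X b d' + (X b' d + u)" using m m' by (simp add: ac_simps)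
  consider "(a, c') = (b, d')" | "(a', c) = (b', d)" "(a, c') \<noteq> (b, d')"
    | "(a, c') = (b', d)" | "(a', c) = (b, d')"
    | "(a, c') \<noteq> (b, d')" "(a', c) \<noteq> (b', d)" "(a, c') \<noteq> (b', d)" "(a', c) \<noteq> (b, d')"
    by blast
  then show ?thesis
  proof cases
    case 1
    then have eq': "X a' c + w = X b' d + u" using eq by simp
    show ?thesis
    proof (cases "(a', c) = (b', d)")
      case True
      then show ?thesis using 1 eq' n n' by simp
    next
      case False
      obtain s where s: "w = X b' d + s" "u = X a' c + s" using eq' False by (rule X_add_eqE)
      have "joinable R (X a c + X a' c' + X b' d) (X a d + X b' c' + X a' c)"
        using overlap_upper A B 1 by simp
      from joinable_add[OF this, of s] show ?thesis using 1 n n' s by (simp add: ac_simps)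
    qed
  next
    case 2
    have eq': "X a c' + w = X b d' + u" using eq 2(1) by (metis Pair_inject add.left_commute add_left_cancel)
    obtain s where s: "w = X b d' + s" "u = X a c' + s" using eq' 2(2) by (rule X_add_eqE)
    have "joinable R (X a c + X a' c' + X b d') (X b c + X a' d' + X a c')"
      using overlap_lower A B 2 by simp
    from joinable_add[OF this, of s] show ?thesis using 2 n n' s by (simp add: ac_simps)
  next
    case 3
    have neq: "(a', c) \<noteq> (b, d')" using 3 A(1) B(1) lr_trans lr_irrefl by blast
    have eq': "X a' c + w = X b d' + u" using eq 3 by (metis Pair_inject add.left_commute add_left_cancel)
    obtain s where s: "w = X b d' + s" "u = X a' c + s" using eq' neq by (rule X_add_eqE)
    have "joinable R (X b c' + X a d' + X a' c) (X a c + X a' c' + X b d')"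
      using overlap_chain[of c c' d' b a a'] A B 3 by simp
    from joinable_add[OF joinable_sym[OF this], of s] show ?thesis
      using 3 n n' s by (simp add: ac_simps)
  next
    case 4
    have neq: "(a, c') \<noteq> (b', d)" using 4 A(1) B(1) lr_trans lr_irrefl by blast
    have eq': "X a c' + w = X b' d + u" using eq 4 by (metis Pair_inject add.left_commute add_left_cancel)
    obtain s where s: "w = X b' d + s" "u = X a c' + s" using eq' neq by (rule X_add_eqE)
    have "joinable R (X a d' + X b c' + X b' d) (X b d + X b' d' + X a c')"
      using overlap_chain[of d d' c' a b b'] A B 4 by simp
    from joinable_add[OF this, of s] show ?thesis
      using 4 n n' s by (simp add: ac_simps)
  next
    case 5
    obtain s1 where s1: "X a' c + w = X b d' + s1" "X b' d + u = X a c' + s1"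
      using eq 5(1) by (rule X_add_eqE)
    obtain s2 where s2: "w = X b d' + s2" "s1 = X a' c + s2" using s1(1) 5(4) by (rule X_add_eqE)
    obtain s3 where s3: "u = X a c' + s3" "s1 = X b' d + s3"
      using s1(2) 5(3)[symmetric] by (rule X_add_eqE)
    have "X a' c + s2 = X b' d + s3" using s2 s3 by simp
    then obtain s where s: "s2 = X b' d + s" "s3 = X a' c + s" using 5(2) by (rule X_add_eqE)
    have "step R n (X a c + X a' c' + X b d + X b' d' + s)"
      using B n s2 s by (intro stepI[of d d' b b' _ "X a c + X a' c' + s"]) (simp_all add: ac_simps)
    moreover have "step R n' (X a c + X a' c' + X b d + X b' d' + s)"
      using A n' s3 s by (intro stepI[of c c' a a' _ "X b d + X b' d' + s"]) (simp_all add: ac_simps)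
    ultimately show ?thesis using joinable_step_left joinable_step_right joinable_refl by blast
  qed
qed

end


section \<open>Inner intervals in the coordinates of an order\<close>

text \<open>The coordinates \<open>x \<noteq> x'\<close> and \<open>y \<noteq> y'\<close>, each pair in either order, bound an inner interval
  of \<open>P\<close>.\<close>

definition block :: "vertex set set \<Rightarrow> nat \<Rightarrow> nat \<Rightarrow> nat \<Rightarrow> nat \<Rightarrow> bool" where
  "block P x x' y y' \<longleftrightarrow> x \<noteq> x' \<and> y \<noteq> y' \<and>
    (\<forall>a b. min x x' \<le> a \<and> a < max x x' \<and> min y y' \<le> b \<and> b < max y y' \<longrightarrow> cell (a, b) \<in> P)"

lemma block_col_sym: "block P x x' y y' \<longleftrightarrow> block P x' x y y'"
  and block_row_sym: "block P x x' y y' \<longleftrightarrow> block P x x' y' y"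
  by (auto simp: block_def min.commute max.commute)

lemma block_col_split:
  assumes "x0 < x1 \<and> x1 < x2 \<or> x2 < x1 \<and> x1 < x0"
  shows "block P x0 x2 y y' \<longleftrightarrow> block P x0 x1 y y' \<and> block P x1 x2 y y'"
proof -
  have "min x0 x2 \<le> a \<and> a < max x0 x2 \<longleftrightarrow>
    min x0 x1 \<le> a \<and> a < max x0 x1 \<or> min x1 x2 \<le> a \<and> a < max x1 x2" for a
    using assms by (auto simp: min_def max_def)
  moreover have "x0 \<noteq> x1" "x1 \<noteq> x2" "x0 \<noteq> x2" using assms by auto
  ultimately show ?thesis unfolding block_def by blast
qed

lemma block_row_split:
  assumes "y0 < y1 \<and> y1 < y2 \<or> y2 < y1 \<and> y1 < y0"
  shows "block P x x' y0 y2 \<longleftrightarrow> block P x x' y0 y1 \<and> block P x x' y1 y2"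
proof -
  have "min y0 y2 \<le> a \<and> a < max y0 y2 \<longleftrightarrow>
    min y0 y1 \<le> a \<and> a < max y0 y1 \<or> min y1 y2 \<le> a \<and> a < max y1 y2" for a
    using assms by (auto simp: min_def max_def)
  moreover have "y0 \<noteq> y1" "y1 \<noteq> y2" "y0 \<noteq> y2" using assms by auto
  ultimately show ?thesis unfolding block_def by blast
qed

lemma cell_subset_interval_iff:
  "cell (a, b) \<subseteq> interval (x, y) (x', y') \<longleftrightarrow> x \<le> a \<and> a < x' \<and> y \<le> b \<and> b < y'"
  by (auto simp: cell_def interval_def times_subset_iff)

lemma inner_interval_iff_block:
  "inner_interval P (x, y) (x', y') \<longleftrightarrow> x < x' \<and> y < y' \<and> block P x x' y y'"
proof -
  have "(\<forall>C. is_cell C \<and> C \<subseteq> interval (x, y) (x', y') \<longrightarrow> C \<in> P)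
    \<longleftrightarrow> (\<forall>a b. x \<le> a \<and> a < x' \<and> y \<le> b \<and> b < y' \<longrightarrow> cell (a, b) \<in> P)"
    unfolding is_cell_def split_paired_Ex cell_subset_interval_iff[symmetric] by blast
  then show ?thesis
    unfolding inner_interval_def proper_def block_def by (auto simp: min_def max_def)
qed

lemma block_corner_in_vertices:
  assumes "block P x x' y y'" shows "(x, y) \<in> vertices P"
proof -
  define a where "a = (if x < x' then x else x - 1)"
  define b where "b = (if y < y' then y else y - 1)"
  have "min x x' \<le> a \<and> a < max x x'" "min y y' \<le> b \<and> b < max y y'"
    using assms unfolding block_def a_def b_def by auto
  then have "cell (a, b) \<in> P" using assms unfolding block_def by blast
  moreover have "(x, y) \<in> cell (a, b)"
    using assms unfolding block_def a_def b_def by (auto simp: cell_def interval_def)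
  ultimately show ?thesis unfolding vertices_def by blast
qed

text \<open>The \<open>k\<close>-th order of the vertices compares columns first, then rows. For \<open>k > 4\<close> the columns
  in this sense are given by the second coordinate.\<close>

definition col_less :: "nat \<Rightarrow> nat \<Rightarrow> nat \<Rightarrow> bool" where
  "col_less k = (if k \<in> {1, 4, 5, 6} then (<) else (>))"

definition row_less :: "nat \<Rightarrow> nat \<Rightarrow> nat \<Rightarrow> bool" where
  "row_less k = (if k \<in> {3, 4, 6, 7} then (<) else (>))"

definition vertex_at :: "nat \<Rightarrow> nat \<Rightarrow> nat \<Rightarrow> vertex" where
  "vertex_at k c r = (if k \<le> 4 then (c, r) else (r, c))"

definition block_at :: "vertex set set \<Rightarrow> nat \<Rightarrow> nat \<Rightarrow> nat \<Rightarrow> nat \<Rightarrow> nat \<Rightarrow> bool" where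
  "block_at P k x x' y y' = (if k \<le> 4 then block P x x' y y' else block P y y' x x')"

lemma order_index_cases:
  assumes "k \<in> {1..8::nat}"
  obtains "k = 1" | "k = 2" | "k = 3" | "k = 4" | "k = 5" | "k = 6" | "k = 7" | "k = 8"
  using assms by fastforce

lemma vless_vertex_at:
  assumes "k \<in> {1..8}"
  shows "vless k (vertex_at k c r) (vertex_at k c' r')
    \<longleftrightarrow> col_less k c c' \<or> c = c' \<and> row_less k r r'"
  by (rule order_index_cases[OF assms])
    (simp_all add: vless_def vertex_at_def col_less_def row_less_def)

lemma vertex_at_surj: obtains c r where "v = vertex_at k c r"
proof (cases "k \<le> 4")
  case True
  then show thesis using that[of "fst v" "snd v"] by (simp add: vertex_at_def)
next
  case False
  then show thesis using that[of "snd v" "fst v"] by (simp add: vertex_at_def)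
qed

lemma block_at_col_split:
  "col_less k x0 x1 \<Longrightarrow> col_less k x1 x2 \<Longrightarrow>
    block_at P k x0 x2 y y' \<longleftrightarrow> block_at P k x0 x1 y y' \<and> block_at P k x1 x2 y y'"
  by (auto simp: col_less_def block_at_def block_col_split[of x0 x1 x2]
    block_row_split[of x0 x1 x2] split: if_splits)

lemma block_at_row_split:
  "row_less k y0 y1 \<Longrightarrow> row_less k y1 y2 \<Longrightarrow>
    block_at P k x x' y0 y2 \<longleftrightarrow> block_at P k x x' y0 y1 \<and> block_at P k x x' y1 y2"
  by (auto simp: row_less_def block_at_def block_col_split[of y0 y1 y2]
    block_row_split[of y0 y1 y2] split: if_splits)

text \<open>Of the four blocks meeting at \<open>(x1, y1)\<close>, if two opposite ones are present, then so is one of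
  the others. This is invariant under reversing both coordinates.\<close>

definition corner_block :: "vertex set set \<Rightarrow> nat \<Rightarrow> nat \<Rightarrow> nat \<Rightarrow> nat \<Rightarrow> nat \<Rightarrow> nat \<Rightarrow> bool" where
  "corner_block P x0 x1 x2 y0 y1 y2 \<longleftrightarrow> (block P x0 x1 y1 y2 \<and> block P x1 x2 y0 y1 \<longrightarrow>
     block P x0 x1 y0 y1 \<or> block P x1 x2 y1 y2)"

lemma corner_block_reverse: "corner_block P x2 x1 x0 y2 y1 y0 \<longleftrightarrow> corner_block P x0 x1 x2 y0 y1 y2"
  unfolding corner_block_def block_col_sym[of P x2] block_col_sym[of P x1 x0]
    block_row_sym[of P _ _ y2] block_row_sym[of P _ _ y1 y0] by blast

text \<open>The combinatorial condition attached to the \<open>k\<close>-th order. For the indices from 1 to 8 it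
  depends on the parity of \<open>k\<close> only.\<close>

definition corner_condition :: "vertex set set \<Rightarrow> nat \<Rightarrow> bool" where
  "corner_condition P k \<longleftrightarrow> (\<forall>x0 x1 x2 y0 y1 y2.
     col_less k x0 x1 \<and> col_less k x1 x2 \<and> row_less k y0 y1 \<and> row_less k y1 y2 \<longrightarrow>
     (if k \<le> 4 then corner_block P x0 x1 x2 y0 y1 y2 else corner_block P y0 y1 y2 x0 x1 x2))"

lemma corner_conditionD:
  assumes "corner_condition P k"
    and "col_less k x0 x1" "col_less k x1 x2" "row_less k y0 y1" "row_less k y1 y2"
    and "block_at P k x0 x1 y1 y2" "block_at P k x1 x2 y0 y1"
  shows "block_at P k x0 x1 y0 y1 \<or> block_at P k x1 x2 y1 y2"
  using assms unfolding corner_condition_def corner_block_def block_at_def by presburger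

lemma corner_conditionI:
  assumes "\<And>x0 x1 x2 y0 y1 y2. col_less k x0 x1 \<Longrightarrow> col_less k x1 x2 \<Longrightarrow> row_less k y0 y1 \<Longrightarrow>
    row_less k y1 y2 \<Longrightarrow> block_at P k x0 x1 y1 y2 \<Longrightarrow> block_at P k x1 x2 y0 y1 \<Longrightarrow>
    block_at P k x0 x1 y0 y1 \<or> block_at P k x1 x2 y1 y2"
  shows "corner_condition P k"
  using assms unfolding corner_condition_def corner_block_def block_at_def by (cases "k \<le> 4") simp_all

lemma corner_condition_even:
  assumes "k \<in> {2, 4, 6, 8}"
  shows "corner_condition P k \<longleftrightarrow> (\<forall>x0 x1 x2 y0 y1 y2.
    x0 < x1 \<and> x1 < x2 \<and> y0 < y1 \<and> y1 < y2 \<longrightarrow> corner_block P x0 x1 x2 y0 y1 y2)"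
proof -
  consider "k = 2" | "k = 4" | "k = 6" | "k = 8" using assms by auto
  then show ?thesis
    by cases (simp_all add: corner_condition_def col_less_def row_less_def,
      (metis corner_block_reverse)+)
qed

lemma corner_condition_odd:
  assumes "k \<in> {1, 3, 5, 7}"
  shows "corner_condition P k \<longleftrightarrow> (\<forall>x0 x1 x2 y0 y1 y2.
    x0 < x1 \<and> x1 < x2 \<and> y0 > y1 \<and> y1 > y2 \<longrightarrow> corner_block P x0 x1 x2 y0 y1 y2)"
proof -
  consider "k = 1" | "k = 3" | "k = 5" | "k = 7" using assms by auto
  then show ?thesis
    by cases (simp_all add: corner_condition_def col_less_def row_less_def,
      (metis corner_block_reverse)+)
qed

lemma corner_condition_same_parity:
  assumes "W \<in> {{1, 3, 5, 7}, {2, 4, 6, 8}}" "i \<in> W" "k \<in> W"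
  shows "corner_condition P i \<longleftrightarrow> corner_condition P k"
  using assms corner_condition_odd[of i P] corner_condition_odd[of k P]
    corner_condition_even[of i P] corner_condition_even[of k P] by auto

text \<open>The table of the sixteen conditions, with the missing quadrant and the position of the vertex.\<close>

lemma satisfies_piI:
  assumes "x0 < x1" "x1 < x2" "y0 < y1" "y1 < y2"
    and "\<not> quadrant_inner P x0 x1 x2 y0 y1 y2 Q"
    and "\<forall>Q'. Q' \<noteq> Q \<longrightarrow> quadrant_inner P x0 x1 x2 y0 y1 y2 Q'"
    and "(k, Q, v) \<in> {(1, LR, (x0, y1)), (1, LL, (x1, y1)), (2, LL, (x2, y1)), (2, LR, (x1, y1)),
      (3, UL, (x2, y1)), (3, UR, (x1, y1)), (4, UR, (x0, y1)), (4, UL, (x1, y1)),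
      (5, UL, (x1, y0)), (5, LL, (x1, y1)), (6, UR, (x1, y0)), (6, LR, (x1, y1)),
      (7, LR, (x1, y2)), (7, UR, (x1, y1)), (8, LL, (x1, y2)), (8, UL, (x1, y1))}"
  shows "satisfies_pi P k v"
  unfolding satisfies_pi_def Let_def
  by (rule exI[of _ x0], rule exI[of _ x1], rule exI[of _ x2], rule exI[of _ y0],
      rule exI[of _ y1], rule exI[of _ y2]) (rule insertE[OF assms(7)]; (elim insertE emptyE)?; insert assms(1-6); simp)

lemma all_quadrant: "(\<forall>Q. F Q) \<longleftrightarrow> F LL \<and> F LR \<and> F UL \<and> F UR"
  by (metis quadrant.exhaust)

text \<open>In the coordinates of the order, condition (I) is the same for all eight orders, and so is
  condition (II).\<close>

lemma satisfies_pi_I: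
  assumes k: "k \<in> {1..8}" and less: "col_less k v1 x1" "col_less k x1 x2" "row_less k y0 v2" "row_less k v2 y2"
    and blocks: "block_at P k v1 x1 y0 v2" "block_at P k x1 x2 y0 v2" "block_at P k v1 x1 v2 y2"
      "\<not> block_at P k x1 x2 v2 y2"
  shows "satisfies_pi P k (vertex_at k v1 v2)"
proof -
  note defs = col_less_def row_less_def block_at_def vertex_at_def all_quadrant
    inner_interval_iff_block block_col_sym block_row_sym
  from k show ?thesis
  proof (cases rule: order_index_cases)
    case 1
    show ?thesis
      by (rule satisfies_piI[of v1 x1 x2 y2 v2 y0 _ LR]) (use less blocks 1 in \<open>simp_all add: defs\<close>)
  next
    case 2
    show ?thesis
      by (rule satisfies_piI[of x2 x1 v1 y2 v2 y0 _ LL]) (use less blocks 2 in \<open>simp_all add: defs\<close>)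
  next
    case 3
    show ?thesis
      by (rule satisfies_piI[of x2 x1 v1 y0 v2 y2 _ UL]) (use less blocks 3 in \<open>simp_all add: defs\<close>)
  next
    case 4
    show ?thesis
      by (rule satisfies_piI[of v1 x1 x2 y0 v2 y2 _ UR]) (use less blocks 4 in \<open>simp_all add: defs\<close>)
  next
    case 5
    show ?thesis
      by (rule satisfies_piI[of y2 v2 y0 v1 x1 x2 _ UL]) (use less blocks 5 in \<open>simp_all add: defs\<close>)
  next
    case 6
    show ?thesis
      by (rule satisfies_piI[of y0 v2 y2 v1 x1 x2 _ UR]) (use less blocks 6 in \<open>simp_all add: defs\<close>)
  next
    case 7
    show ?thesis
      by (rule satisfies_piI[of y0 v2 y2 x2 x1 v1 _ LR]) (use less blocks 7 in \<open>simp_all add: defs\<close>)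
  next
    case 8
    show ?thesis
      by (rule satisfies_piI[of y2 v2 y0 x2 x1 v1 _ LL]) (use less blocks 8 in \<open>simp_all add: defs\<close>)
  qed
qed

lemma satisfies_pi_II:
  assumes k: "k \<in> {1..8}" and less: "col_less k x0 v1" "col_less k v1 x2" "row_less k y0 v2" "row_less k v2 y2"
    and blocks: "block_at P k x0 v1 y0 v2" "block_at P k v1 x2 y0 v2" "block_at P k v1 x2 v2 y2"
      "\<not> block_at P k x0 v1 v2 y2"
  shows "satisfies_pi P k (vertex_at k v1 v2)"
proof -
  note defs = col_less_def row_less_def block_at_def vertex_at_def all_quadrant
    inner_interval_iff_block block_col_sym block_row_sym
  from k show ?thesis
  proof (cases rule: order_index_cases)
    case 1
    show ?thesis
      by (rule satisfies_piI[of x0 v1 x2 y2 v2 y0 _ LL]) (use less blocks 1 in \<open>simp_all add: defs\<close>)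
  next
    case 2
    show ?thesis
      by (rule satisfies_piI[of x2 v1 x0 y2 v2 y0 _ LR]) (use less blocks 2 in \<open>simp_all add: defs\<close>)
  next
    case 3
    show ?thesis
      by (rule satisfies_piI[of x2 v1 x0 y0 v2 y2 _ UR]) (use less blocks 3 in \<open>simp_all add: defs\<close>)
  next
    case 4
    show ?thesis
      by (rule satisfies_piI[of x0 v1 x2 y0 v2 y2 _ UL]) (use less blocks 4 in \<open>simp_all add: defs\<close>)
  next
    case 5
    show ?thesis
      by (rule satisfies_piI[of y2 v2 y0 x0 v1 x2 _ LL]) (use less blocks 5 in \<open>simp_all add: defs\<close>)
  next
    case 6
    show ?thesis
      by (rule satisfies_piI[of y0 v2 y2 x0 v1 x2 _ LR]) (use less blocks 6 in \<open>simp_all add: defs\<close>)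
  next
    case 7
    show ?thesis
      by (rule satisfies_piI[of y0 v2 y2 x2 v1 x0 _ UR]) (use less blocks 7 in \<open>simp_all add: defs\<close>)
  next
    case 8
    show ?thesis
      by (rule satisfies_piI[of y2 v2 y0 x2 v1 x0 _ UL]) (use less blocks 8 in \<open>simp_all add: defs\<close>)
  qed
qed


section \<open>The polyomino ideal and the eight orders\<close>

locale indexed_order =
  fixes P :: "vertex set set" and k :: nat
  assumes polyomino: "polyomino P" and index: "k \<in> {1..8}"

sublocale indexed_order \<subseteq> grid "col_less k" "row_less k" "block_at P k" "vertex_at k"
proof
  show "col_less k = (<) \<or> col_less k = (>)" by (simp add: col_less_def)
  show "row_less k = (<) \<or> row_less k = (>)" by (simp add: row_less_def)
  show "vertex_at k c r = vertex_at k c' r' \<longleftrightarrow> c = c' \<and> r = r'" for c r c' r'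
    by (auto simp: vertex_at_def)
  show "block_at P k x' x y y'" if "block_at P k x x' y y'" for x x' y y'
    using that by (simp add: block_at_def block_col_sym block_row_sym split: if_splits)
  show "block_at P k x x' y' y" if "block_at P k x x' y y'" for x x' y y'
    using that by (simp add: block_at_def block_col_sym block_row_sym split: if_splits)
  show "x \<noteq> x' \<and> y \<noteq> y'" if "block_at P k x x' y y'" for x x' y y'
    using that by (auto simp: block_at_def block_def split: if_splits)
qed (rule block_at_col_split block_at_row_split; assumption)+

context indexed_order
begin

lemma vless_irrefl: "\<not> vless k a a"
  and vless_trans: "vless k a b \<Longrightarrow> vless k b c \<Longrightarrow> vless k a c"
  and vless_total: "a \<noteq> b \<Longrightarrow> vless k a b \<or> vless k b a"
proof -
  obtain a1 a2 b1 b2 c1 c2 where v: "a = vertex_at k a1 a2" "b = vertex_at k b1 b2" "c = vertex_at k c1 c2"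
    using vertex_at_surj by metis
  note less = vless_vertex_at[OF index]
  show "\<not> vless k a a" unfolding v less using lc_irrefl lr_irrefl by blast
  show "vless k a b \<Longrightarrow> vless k b c \<Longrightarrow> vless k a c"
    unfolding v less using lc_trans lr_trans by blast
  show "a \<noteq> b \<Longrightarrow> vless k a b \<or> vless k b a"
    unfolding v less using lc_total lr_total by blast
qed

lemma finite_vertices: "finite (vertices P)"
proof -
  have "finite C" if "C \<in> P" for C
    using that polyomino by (auto simp: polyomino_def is_cell_def cell_def interval_def)
  then show ?thesis using polyomino by (auto simp: vertices_def polyomino_def)
qed

lemma grevlex_order_vless: "grevlex_order (vertices P) (vless k)"
  by unfold_locales (use finite_vertices vless_irrefl vless_trans vless_total in blast)+

lemma grevlex_order_vless_from: "grevlex_order (vertices P) (vless_from k v)"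
proof
  show "vless_from k v a c" if "vless_from k v a b" "vless_from k v b c" for a b c
    using that vless_trans[of a b c] by (auto simp: vless_from_def split: if_splits)
qed (use finite_vertices vless_irrefl vless_total in \<open>auto simp: vless_from_def\<close>)

lemma block_vertices:
  assumes "block_at P k x x' y y'"
  shows "{vertex_at k x y, vertex_at k x y', vertex_at k x' y, vertex_at k x' y'} \<subseteq> vertices P"
proof -
  have "vertex_at k x y \<in> vertices P" if "block_at P k x x' y y'" for x x' y y'
    using that block_corner_in_vertices unfolding block_at_def vertex_at_def
    by (auto split: if_splits)
  then show ?thesis using assms inn_col_sym inn_row_sym by blast
qed

lemma keys_X: "Poly_Mapping.keys (X c r) = {vertex_at k c r}"
  by (simp add: X_def)

lemma inner_minors_eq:
  "inner_minors P = {monom_poly (X x y + X x' y') - monom_poly (X x y' + X x' y) | x x' y y'.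
     x < x' \<and> y < y' \<and> block_at P k x x' y y'}"
  (is "_ = ?M")
proof -
  have minor: "var a * var b - var (upper_left a b) * var (lower_right a b) =
    (monom_poly (Poly_Mapping.single a 1 + Poly_Mapping.single b 1) -
     monom_poly (Poly_Mapping.single (fst a, snd b) 1 + Poly_Mapping.single (fst b, snd a) 1))"
    for a b by (simp add: var_def monom_poly_mult upper_left_def lower_right_def)
  show ?thesis
    unfolding inner_minors_def minor
    by (cases "k \<le> 4") (auto simp: X_def vertex_at_def block_at_def inner_interval_iff_block add.commute)
qed

text \<open>The order of the rows and the orders \<open>lt\<close> of the columns select a sign for each inner
  2-minor. The last assumption says that the smallest corner belongs to the monomial that becomes
  the trailing one.\<close>

lemma binomial_rewriting_rules:
  assumes r: "grevlex_order (vertices P) r"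
    and total: "\<And>y a b. lt y a b \<or> a = b \<or> lt y b a"
    and smallest: "\<And>x x' y y'. row_less k y y' \<Longrightarrow> lt y x x' \<Longrightarrow>
      \<exists>a\<in>{vertex_at k x y, vertex_at k x' y'}. r a (vertex_at k x y') \<and> r a (vertex_at k x' y)"
  shows "binomial_rewriting (vertices P) r (rules lt) (inner_minors P :: 'f::field mpoly set)"
proof -
  interpret grevlex_order "vertices P" r by (rule r)
  show ?thesis
  proof
    let ?V = "vertices P"
    have "rules lt \<subseteq> (\<lambda>(a, b, c, d). (Poly_Mapping.single a 1 + Poly_Mapping.single b 1,
        Poly_Mapping.single c 1 + Poly_Mapping.single d 1)) ` (?V \<times> ?V \<times> ?V \<times> ?V)"
      unfolding rules_def X_def using block_vertices by force
    then show "finite (rules lt)"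
      by (rule finite_subset) (intro finite_imageI finite_cartesian_product finite_vertices)
  next
    fix l t assume "(l, t) \<in> rules lt"
    then obtain x x' y y' where l: "l = X x y' + X x' y" and t: "t = X x y + X x' y'"
      and y: "row_less k y y'" and x: "lt y x x'" and b: "block_at P k x x' y y'"
      unfolding rules_def by blast
    show "Poly_Mapping.keys l \<subseteq> vertices P \<and> Poly_Mapping.keys t \<subseteq> vertices P"
      using block_vertices[OF b] keys_add[of "X x y'" "X x' y"] keys_add[of "X x y" "X x' y'"]
      unfolding l t keys_X by blast
    obtain a where "a \<in> {vertex_at k x y, vertex_at k x' y'}" "r a (vertex_at k x y')"
      "r a (vertex_at k x' y)" using smallest[OF y x] by blast
    then show "ord t l"
      unfolding l t X_def using block_vertices[OF b] by (intro ord_pair[where a = a]) auto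
    have minor: "monom_poly (X x y + X x' y') - monom_poly (X x y' + X x' y) \<in> inner_minors P"
      if "x < x'" "y < y'" "block_at P k x x' y y'" for x x' y y'
      using that unfolding inner_minors_eq by blast
    have "x < x' \<or> x' < x" "y < y' \<or> y' < y" using inn_neq[OF b] by auto
    then show "monom_poly l - monom_poly t \<in> (inner_minors P :: 'f mpoly set) \<or>
      monom_poly t - monom_poly l \<in> (inner_minors P :: 'f mpoly set)"
      using minor[of x x' y y'] minor[of x' x y y'] minor[of x x' y' y] minor[of x' x y' y]
        b inn_col_sym inn_row_sym unfolding l t by (metis add.commute)
  next
    fix g :: "'f mpoly" assume "g \<in> inner_minors P"
    then obtain x x' y y' where g: "g = monom_poly (X x y + X x' y') - monom_poly (X x y' + X x' y)"
      and b: "block_at P k x x' y y'" unfolding inner_minors_eq by blast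
    have rule: "(X x y' + X x' y, X x y + X x' y') \<in> rules lt"
      if "row_less k y y'" "lt y x x'" "block_at P k x x' y y'" for x x' y y'
      using that unfolding rules_def by blast
    have "lt y x x' \<or> lt y x' x" "lt y' x x' \<or> lt y' x' x" "row_less k y y' \<or> row_less k y' y"
      using total lr_total inn_neq[OF b] by blast+
    then show "\<exists>l t. (l, t) \<in> rules lt \<and>
      (g = monom_poly l - monom_poly t \<or> g = monom_poly t - monom_poly l)"
      using rule[of y y' x x'] rule[of y y' x' x] rule[of y' y x x'] rule[of y' y x' x]
        b inn_col_sym inn_row_sym unfolding g by (metis add.commute)
  qed
qed

text \<open>Sorting the product of the vertices \<open>(x0, y2), (x1, y1), (x2, y0)\<close> in two ways gives
  monomials \<open>p\<close> and \<open>q\<close> whose difference lies in the ideal. So one of them is divisible by a leading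
  monomial, and then one of the two blocks in question is present.\<close>

lemma corner_condition_if_groebner_basis:
  assumes "reduced_groebner_basis_up_to_sign (vertices P) (grevlex_std P k)
    (polyomino_ideal P) (inner_minors P :: 'f::field mpoly set)"
  shows "corner_condition P k"
proof (rule corner_conditionI)
  let ?R = "rules (\<lambda>_. col_less k)"
  interpret binomial_rewriting "vertices P" "vless k" ?R "inner_minors P :: 'f mpoly set"
    by (rule binomial_rewriting_rules)
      (use grevlex_order_vless lc_total in \<open>auto simp: vless_vertex_at[OF index]\<close>)
  have divisible: "\<exists>(l, t)\<in>?R. monom_dvd l (lead_monom ord f)"
    if "f \<in> ideal_gen (vertices P) (inner_minors P :: 'f mpoly set)" "f \<noteq> 0" for f
    using assms that groebner_basis_iff
    unfolding reduced_groebner_basis_up_to_sign_def reduced_groebner_basis_def grevlex_std_def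
      polyomino_ideal_def adjust_sign_image by blast
  fix x0 x1 x2 y0 y1 y2
  assume x: "col_less k x0 x1" "col_less k x1 x2" and y: "row_less k y0 y1" "row_less k y1 y2"
    and UL: "block_at P k x0 x1 y1 y2" and LR: "block_at P k x1 x2 y0 y1"
  define m where "m = X x0 y2 + X x1 y1 + X x2 y0"
  define p where "p = X x0 y1 + X x1 y2 + X x2 y0"
  define q where "q = X x1 y0 + X x2 y1 + X x0 y2"
  have x': "col_less k x0 x2" and y': "row_less k y0 y2" using x y lc_trans lr_trans by blast+
  have neq: "x0 \<noteq> x1" "x1 \<noteq> x2" "x0 \<noteq> x2" "y0 \<noteq> y1" "y1 \<noteq> y2" "y0 \<noteq> y2"
    using x y x' y' lc_irrefl lr_irrefl by blast+
  have keys: "Poly_Mapping.keys m \<subseteq> vertices P"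
    using block_vertices[OF UL] block_vertices[OF LR] keys_add[of "X x0 y2 + X x1 y1" "X x2 y0"]
      keys_add[of "X x0 y2" "X x1 y1"] unfolding m_def keys_X by blast
  have "step ?R m p"
    unfolding step_def rules_def m_def p_def using x y UL by blast
  moreover have "step ?R m q"
  proof -
    have "(X x1 y1 + X x2 y0, X x1 y0 + X x2 y1) \<in> ?R" unfolding rules_def using x y LR by blast
    moreover have "m = (X x1 y1 + X x2 y0) + X x0 y2" by (simp add: m_def ac_simps)
    ultimately show ?thesis unfolding step_def q_def by blast
  qed
  ultimately have "(monom_poly m - monom_poly q) - (monom_poly m - monom_poly p)
      \<in> ideal_gen (vertices P) (inner_minors P :: 'f mpoly set)"
    using keys by (intro ideal_gen_diff step_diff_in_ideal)
  then have ideal: "monom_poly p - monom_poly q \<in> ideal_gen (vertices P) (inner_minors P :: 'f mpoly set)"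
    by simp
  have "Poly_Mapping.lookup p (vertex_at k x2 y0) \<noteq> Poly_Mapping.lookup q (vertex_at k x2 y0)"
    using neq by (simp add: p_def q_def X_def lookup_add lookup_single vx_inj)
  then have "p \<noteq> q" by blast
  then have lookup: "Poly_Mapping.lookup (monom_poly p - monom_poly q :: 'f mpoly) p = 1"
    by (simp add: lookup_minus lookup_monom_poly)
  then have nz: "(monom_poly p - monom_poly q :: 'f mpoly) \<noteq> 0" by auto
  define e where "e = lead_monom ord (monom_poly p - monom_poly q :: 'f mpoly)"
  have "e \<in> Poly_Mapping.keys (monom_poly p - monom_poly q :: 'f mpoly)"
    using lead_monom_greatest(1) ideal nz ideal_subset_poly_ring unfolding e_def by blast
  then have e: "e = p \<or> e = q"
    by (auto simp: in_keys_iff lookup_minus lookup_monom_poly split: if_splits)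
  obtain l t where lt: "(l, t) \<in> ?R" and "monom_dvd l e"
    using divisible[OF ideal nz] unfolding e_def by blast
  then obtain u a a' b b' where eu: "e = X a b' + X a' b + u" and a: "col_less k a a'"
    and b: "row_less k b b'" and block: "block_at P k a a' b b'"
    unfolding rules_def monom_dvd_def by blast
  have keys_e: "{vertex_at k a b', vertex_at k a' b} \<subseteq> Poly_Mapping.keys e"
    by (auto simp: eu X_def in_keys_iff lookup_add)
  have sorted: "a = x0 \<and> a' = x2 \<and> b = y0 \<and> b' = y1 \<or> a = x1 \<and> a' = x2 \<and> b = y0 \<and> b' = y2 \<or>
    a = x0 \<and> a' = x1 \<and> b = y0 \<and> b' = y2 \<or> a = x0 \<and> a' = x2 \<and> b = y1 \<and> b' = y2"
  proof -
    have p: "Poly_Mapping.keys p \<subseteq> {vertex_at k x0 y1, vertex_at k x1 y2, vertex_at k x2 y0}"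
      and q: "Poly_Mapping.keys q \<subseteq> {vertex_at k x1 y0, vertex_at k x2 y1, vertex_at k x0 y2}"
      by (auto simp: p_def q_def X_def in_keys_iff lookup_add lookup_single when_def split: if_splits)
    have "\<not> col_less k x1 x0" "\<not> col_less k x2 x1" "\<not> col_less k x2 x0"
      "\<not> row_less k y1 y0" "\<not> row_less k y2 y1" "\<not> row_less k y2 y0"
      using x y x' y' lc_trans lr_trans lc_irrefl lr_irrefl by blast+
    note not_less = this lc_irrefl lr_irrefl
    from e show ?thesis
    proof
      assume "e = p"
      then have "vertex_at k a b' \<in> {vertex_at k x0 y1, vertex_at k x1 y2, vertex_at k x2 y0}"
        "vertex_at k a' b \<in> {vertex_at k x0 y1, vertex_at k x1 y2, vertex_at k x2 y0}"
        using keys_e p by blast+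
      then show ?thesis
        using a b not_less by (simp add: vx_inj) (elim disjE conjE; simp)
    next
      assume "e = q"
      then have "vertex_at k a b' \<in> {vertex_at k x1 y0, vertex_at k x2 y1, vertex_at k x0 y2}"
        "vertex_at k a' b \<in> {vertex_at k x1 y0, vertex_at k x2 y1, vertex_at k x0 y2}"
        using keys_e q by blast+
      then show ?thesis
        using a b not_less by (simp add: vx_inj) (elim disjE conjE; simp)
    qed
  qed
  then show "block_at P k x0 x1 y0 y1 \<or> block_at P k x1 x2 y1 y2"
    using block inn_col_split[OF x] inn_row_split[OF y] by blast
qed

lemma groebner_basis_rotated:
  assumes "corner_condition P k" and "\<not> satisfies_pi P k v"
  shows "reduced_groebner_basis_up_to_sign (vertices P) (grevlex_from P k v)
    (polyomino_ideal P) (inner_minors P :: 'f::field mpoly set)"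
proof -
  obtain v1 v2 where v: "v = vertex_at k v1 v2" using vertex_at_surj .
  interpret rotated_grid "col_less k" "row_less k" "block_at P k" "vertex_at k" v1 v2
  proof
    show "block_at P k x1 x2 v2 y2" if "col_less k v1 x1" "col_less k x1 x2" "row_less k y0 v2"
      "row_less k v2 y2" "block_at P k v1 x1 y0 v2" "block_at P k x1 x2 y0 v2" "block_at P k v1 x1 v2 y2"
      for x1 x2 y0 y2
      using satisfies_pi_I[OF index that] assms(2) v by blast
    show "block_at P k x0 v1 v2 y2" if "col_less k x0 v1" "col_less k v1 x2" "row_less k y0 v2"
      "row_less k v2 y2" "block_at P k x0 v1 y0 v2" "block_at P k v1 x2 y0 v2" "block_at P k v1 x2 v2 y2"
      for x0 x2 y0 y2
      using satisfies_pi_II[OF index that] assms(2) v by blast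
  qed (use corner_conditionD[OF assms(1)] in blast)
  have less: "vless_from k v (vertex_at k c e) (vertex_at k c' e') \<longleftrightarrow>
    (if low e c = low e' c' then col_less k c c' \<or> c = c' \<and> row_less k e e' else low e' c')" for c c' e e'
    unfolding vless_from_def v vless_vertex_at[OF index] low_def by simp
  interpret binomial_rewriting "vertices P" "vless_from k v" R "inner_minors P :: 'f mpoly set"
  proof (rule binomial_rewriting_rules[OF grevlex_order_vless_from lt_total])
    fix x x' y y' assume y: "row_less k y y'" and x: "lt y x x'"
    have neq: "x \<noteq> x'" using x lt_irrefl by blast
    have low_mono: "low y c" if "low y' c" for c using that y lr_trans unfolding low_def by blast
    show "\<exists>a\<in>{vertex_at k x y, vertex_at k x' y'}.
      vless_from k v a (vertex_at k x y') \<and> vless_from k v a (vertex_at k x' y)"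
    proof (cases "low y' x' = low y x'")
      case True
      have "low y' x = low y x"
      proof (rule ccontr)
        assume "low y' x \<noteq> low y x"
        then have "x = v1" "low y x" using low_mono unfolding low_def by blast+
        then have "low y x'" "col_less k x x'" using x unfolding lt_def by metis+
        then show False
          using \<open>x = v1\<close> lc_trans lc_irrefl unfolding low_def by blast
      qed
      then have "vless_from k v (vertex_at k x y) (vertex_at k x y')" using y by (simp add: less)
      moreover have "vless_from k v (vertex_at k x y) (vertex_at k x' y)"
        using x unfolding less lt_def by metis
      ultimately show ?thesis by blast
    next
      case False
      then have x': "x' = v1" "low y x'" "\<not> low y' x'" using low_mono unfolding low_def by blast+
      have "low y' x \<or> col_less k x' x"
        using neq x'(1) lc_total[of x x'] unfolding low_def by blast
      then have "vless_from k v (vertex_at k x' y') (vertex_at k x y')"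
        using x'(3) by (auto simp: less)
      moreover have "vless_from k v (vertex_at k x' y') (vertex_at k x' y)"
        using x'(2,3) by (simp add: less)
      ultimately show ?thesis by blast
    qed
  qed
  show ?thesis
    unfolding grevlex_from_def polyomino_ideal_def
  proof (rule reduced_if_groebner_basis)
    show "groebner_basis (vertices P) ord (ideal_gen (vertices P) (inner_minors P)) (binomials :: 'f mpoly set)"
      by (rule groebner_basis_if_locally_confluent) (rule locally_confluent)
    show "(l', l) \<notin> R" if "(l, t) \<in> R" for l t l'
      using lt_asym that by (rule rules_irreversible)
  qed (use mdegree_rules rules_det in blast)+
qed

end

theorem proposition2p3:
  fixes P :: "vertex set set"
  assumes "polyomino P"
  shows "\<forall>W \<in> {{1, 3, 5, 7}, {2, 4, 6, 8}}.
    (\<exists>i\<in>W. reduced_groebner_basis_up_to_sign (vertices P) (grevlex_std P i)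
       (polyomino_ideal P) (inner_minors P :: 'k::field mpoly set)) \<longrightarrow>
    (\<forall>v\<in>vertices P. \<forall>k\<in>W. \<not> satisfies_pi P k v \<longrightarrow>
       reduced_groebner_basis_up_to_sign (vertices P) (grevlex_from P k v)
         (polyomino_ideal P) (inner_minors P :: 'k mpoly set))"
proof (intro ballI impI, elim bexE)
  fix W :: "nat set" and i k v
  assume W: "W \<in> {{1, 3, 5, 7}, {2, 4, 6, 8}}" and i: "i \<in> W" and k: "k \<in> W"
    and gb: "reduced_groebner_basis_up_to_sign (vertices P) (grevlex_std P i)
       (polyomino_ideal P) (inner_minors P :: 'k::field mpoly set)"
    and v: "\<not> satisfies_pi P k v"
  have "i \<in> {1..8}" "k \<in> {1..8}" using W i k by auto
  then interpret I: indexed_order P i + K: indexed_order P k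
    using assms by unfold_locales
  have "corner_condition P k"
    using I.corner_condition_if_groebner_basis[OF gb] corner_condition_same_parity[OF W i k] by blast
  then show "reduced_groebner_basis_up_to_sign (vertices P) (grevlex_from P k v)
         (polyomino_ideal P) (inner_minors P :: 'k mpoly set)"
    using K.groebner_basis_rotated v by blast
qed

end
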